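(* Let $A\,|\,B\,|\,C$ be a left depth three tower of rings such that the composite extension $A\,|\,C$ is depth two. Then $\operatorname{End}{}_CA_B$ is a left coideal subring of the left bialgebroid $\operatorname{End}{}_CA_C$ over $V=A^C$, and there is a ring isomorphism $$\operatorname{End}A_B\;\cong\;A\rtimes\operatorname{End}{}_CA_B$$ with the smash product ring.
   Context: Rings are unital. A tower $A\,|\,B\,|\,C$ is a pair of unital ring homomorphisms $C\to B\to A$, with induced bimodule structures. It is left depth three if, as $C$-$A$-bimodules, $A\otimes_BA$ is isomorphic to a direct summand of $A^N$ for some positive integer $N$. A ring extension $A\,|\,C$ is depth two (D2) if $A\otimes_CA$ is isomorphic to a direct summand of some $A^N$ both as $A$-$C$-bimodules and as $C$-$A$-bimodules. $V=A^C=\{a\in A: ac=ca\ \forall c\in C\}$. Write $S=\operatorname{End}{}_CA_C$ ($C$-$C$-bimodule endomorphisms of $A$, a ring under composition), with $V$-$V$-bimodule structure $(v\cdot\beta\cdot v')(a)=v\beta(a)v'$. When $A\,|\,C$ is D2, there exist right D2 quasibases $\tilde\gamma_k\in S$, $\tilde u_k=\tilde u_k^1\otimes_C\tilde u_k^2\in(A\otimes_CA)^C$ (finitely many), i.e. $x\otimes_Cy=\sum_k x\tilde\gamma_k(y)\tilde u_k$ for all $x,y\in A$, and $S$ is a left $V$-bialgebroid with coproduct $\Delta:S\to S\otimes_VS$, $\Delta(\beta)=\beta_{(1)}\otimes_V\beta_{(2)}=\sum_k\tilde\gamma_k\otimes_V\tilde u_k^1\beta(\tilde u_k^2\,-)$,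 equivalently the unique element with $\beta(xy)=\beta_{(1)}(x)\beta_{(2)}(y)$ for all $x,y\in A$; the counit is $\beta\mapsto\beta(1)$. $S$ acts on $A$ by evaluation, $\beta\triangleright a=\beta(a)$. A left coideal subring of $S$ is a subring $\mathcal J\subseteq S$ that is a left $V$-submodule and satisfies $\Delta(\mathcal J)\subseteq S\otimes_V\mathcal J$. The smash product $A\rtimes\mathcal J$ is the abelian group $A\otimes_V\mathcal J$ (writing $a\#\alpha$ for $a\otimes_V\alpha$) with multiplication $(a\#\alpha)(b\#\beta)=a(\alpha_{(1)}\triangleright b)\#\alpha_{(2)}\circ\beta$. $\operatorname{End}A_B$ is the ring of right $B$-linear endomorphisms of $A$ under composition, and $\operatorname{End}{}_CA_B$ the ring of $C$-$B$-bimodule endomorphisms. *)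

theory Defs
  imports "HOL-Algebra.Algebra"
begin

section \<open>Tensor products over a noncommutative ring\<close>

text \<open>
  Abelian groups are written multiplicatively, as in HOL-Algebra; the additive group of a ring
  \<open>R\<close> is \<^term>\<open>add_monoid R\<close>. Here \<open>M\<close> carries a right action \<open>ra\<close> and \<open>N\<close> a left action \<open>la\<close>
  of the scalars in the set \<open>R\<close>.
\<close>

definition tensor_kernel ::
    "'r set \<Rightarrow> 'm monoid \<Rightarrow> ('m \<Rightarrow> 'r \<Rightarrow> 'm) \<Rightarrow> 'n monoid \<Rightarrow> ('r \<Rightarrow> 'n \<Rightarrow> 'n) \<Rightarrow> ('m \<times> 'n \<Rightarrow>\<^sub>0 int) set"
  where "tensor_kernel R M ra N la =
    generate (free_Abelian_group (carrier M \<times> carrier N))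
      ({frag_of (m \<otimes>\<^bsub>M\<^esub> m', n) - frag_of (m, n) - frag_of (m', n) | m m' n.
          m \<in> carrier M \<and> m' \<in> carrier M \<and> n \<in> carrier N} \<union>
       {frag_of (m, n \<otimes>\<^bsub>N\<^esub> n') - frag_of (m, n) - frag_of (m, n') | m n n'.
          m \<in> carrier M \<and> n \<in> carrier N \<and> n' \<in> carrier N} \<union>
       {frag_of (ra m r, n) - frag_of (m, la r n) | m r n.
          m \<in> carrier M \<and> r \<in> R \<and> n \<in> carrier N})"

definition tensor ::
    "'r set \<Rightarrow> 'm monoid \<Rightarrow> ('m \<Rightarrow> 'r \<Rightarrow> 'm) \<Rightarrow> 'n monoid \<Rightarrow> ('r \<Rightarrow> 'n \<Rightarrow> 'n)
      \<Rightarrow> (('m \<times> 'n \<Rightarrow>\<^sub>0 int) set) monoid"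
  where "tensor R M ra N la =
    free_Abelian_group (carrier M \<times> carrier N) Mod tensor_kernel R M ra N la"

definition pure_tensor ::
    "'r set \<Rightarrow> 'm monoid \<Rightarrow> ('m \<Rightarrow> 'r \<Rightarrow> 'm) \<Rightarrow> 'n monoid \<Rightarrow> ('r \<Rightarrow> 'n \<Rightarrow> 'n)
      \<Rightarrow> 'm \<Rightarrow> 'n \<Rightarrow> ('m \<times> 'n \<Rightarrow>\<^sub>0 int) set"
  where "pure_tensor R M ra N la m n =
    tensor_kernel R M ra N la #>\<^bsub>free_Abelian_group (carrier M \<times> carrier N)\<^esub> frag_of (m, n)"

text \<open>
  The homomorphism out of a tensor product induced by a balanced biadditive map \<open>\<phi>\<close> into an
  abelian group \<open>H\<close>, evaluated at the tensor (i.e. coset of formal sums) \<open>T\<close>. For balanced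
  \<open>\<phi>\<close> all representatives of \<open>T\<close> give the same value.
\<close>

definition tensor_lift ::
    "'h monoid \<Rightarrow> ('m \<Rightarrow> 'n \<Rightarrow> 'h) \<Rightarrow> ('m \<times> 'n \<Rightarrow>\<^sub>0 int) set \<Rightarrow> 'h"
  where "tensor_lift H \<phi> T =
    the_elem ((\<lambda>F. \<Otimes>\<^bsub>H\<^esub>p \<in> Poly_Mapping.keys F.
                 \<phi> (fst p) (snd p) [^]\<^bsub>H\<^esub> Poly_Mapping.lookup F p) ` T)"


section \<open>Bimodules and direct summands\<close>

record ('r, 'm, 's) bimod = "'m monoid" +
  lact :: "'r \<Rightarrow> 'm \<Rightarrow> 'm"
  ract :: "'m \<Rightarrow> 's \<Rightarrow> 'm"

definition bimod_hom ::
    "'r ring \<Rightarrow> 's ring \<Rightarrow> ('r, 'm, 's) bimod \<Rightarrow> ('r, 'n, 's) bimod \<Rightarrow> ('m \<Rightarrow> 'n) set"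
  where "bimod_hom R S M N =
    {h \<in> hom M N. (\<forall>r \<in> carrier R. \<forall>m \<in> carrier M. h (lact M r m) = lact N r (h m)) \<and>
                  (\<forall>s \<in> carrier S. \<forall>m \<in> carrier M. h (ract M m s) = ract N (h m) s)}"

definition subbimod :: "'r ring \<Rightarrow> 's ring \<Rightarrow> 'm set \<Rightarrow> ('r, 'm, 's) bimod \<Rightarrow> bool"
  where "subbimod R S P M \<longleftrightarrow> subgroup P M \<and>
    (\<forall>r \<in> carrier R. \<forall>m \<in> P. lact M r m \<in> P) \<and>
    (\<forall>s \<in> carrier S. \<forall>m \<in> P. ract M m s \<in> P)"

definition direct_summand :: "'r ring \<Rightarrow> 's ring \<Rightarrow> 'm set \<Rightarrow> ('r, 'm, 's) bimod \<Rightarrow> bool"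
  where "direct_summand R S P M \<longleftrightarrow> subbimod R S P M \<and>
    (\<exists>Q. subbimod R S Q M \<and> P \<inter> Q = {\<one>\<^bsub>M\<^esub>} \<and> P <#>\<^bsub>M\<^esub> Q = carrier M)"

definition iso_to_direct_summand ::
    "'r ring \<Rightarrow> 's ring \<Rightarrow> ('r, 'm, 's) bimod \<Rightarrow> ('r, 'n, 's) bimod \<Rightarrow> bool"
  where "iso_to_direct_summand R S M N \<longleftrightarrow>
    (\<exists>P h. direct_summand R S P N \<and>
           h \<in> bimod_hom R S M (N\<lparr>carrier := P\<rparr>) \<and> bij_betw h (carrier M) P)"

text \<open>\<open>A\<^sup>N\<close> with left and right scalars acting through \<open>l\<close> and \<open>r\<close>.\<close>

definition power_bimod ::
    "'a ring \<Rightarrow> ('r \<Rightarrow> 'a) \<Rightarrow> ('s \<Rightarrow> 'a) \<Rightarrow> nat \<Rightarrow> ('r, nat \<Rightarrow> 'a, 's) bimod"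
  where "power_bimod A l r N =
    monoid.extend (product_group {..<N} (\<lambda>_. add_monoid A))
      (bimod.fields (\<lambda>x f. \<lambda>k \<in> {..<N}. l x \<otimes>\<^bsub>A\<^esub> f k) (\<lambda>f y. \<lambda>k \<in> {..<N}. f k \<otimes>\<^bsub>A\<^esub> r y))"


section \<open>Tensor squares of ring extensions; depth two and depth three\<close>

text \<open>A ring extension \<open>A | R\<close> is given by a unital ring homomorphism \<open>i\<close> from \<open>R\<close> to \<open>A\<close>.\<close>

definition tensor_sq :: "'a ring \<Rightarrow> 'r ring \<Rightarrow> ('r \<Rightarrow> 'a) \<Rightarrow> (('a \<times> 'a \<Rightarrow>\<^sub>0 int) set) monoid"
  where "tensor_sq A R i =
    tensor (carrier R) (add_monoid A) (\<lambda>x r. x \<otimes>\<^bsub>A\<^esub> i r) (add_monoid A) (\<lambda>r x. i r \<otimes>\<^bsub>A\<^esub> x)"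

definition pure_sq ::
    "'a ring \<Rightarrow> 'r ring \<Rightarrow> ('r \<Rightarrow> 'a) \<Rightarrow> 'a \<Rightarrow> 'a \<Rightarrow> ('a \<times> 'a \<Rightarrow>\<^sub>0 int) set"
  where "pure_sq A R i =
    pure_tensor (carrier R) (add_monoid A) (\<lambda>x r. x \<otimes>\<^bsub>A\<^esub> i r) (add_monoid A) (\<lambda>r x. i r \<otimes>\<^bsub>A\<^esub> x)"

definition lmult_sq ::
    "'a ring \<Rightarrow> 'r ring \<Rightarrow> ('r \<Rightarrow> 'a) \<Rightarrow> 'a \<Rightarrow> ('a \<times> 'a \<Rightarrow>\<^sub>0 int) set \<Rightarrow> ('a \<times> 'a \<Rightarrow>\<^sub>0 int) set"
  where "lmult_sq A R i a = tensor_lift (tensor_sq A R i) (\<lambda>x y. pure_sq A R i (a \<otimes>\<^bsub>A\<^esub> x) y)"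

definition rmult_sq ::
    "'a ring \<Rightarrow> 'r ring \<Rightarrow> ('r \<Rightarrow> 'a) \<Rightarrow> ('a \<times> 'a \<Rightarrow>\<^sub>0 int) set \<Rightarrow> 'a \<Rightarrow> ('a \<times> 'a \<Rightarrow>\<^sub>0 int) set"
  where "rmult_sq A R i T a = tensor_lift (tensor_sq A R i) (\<lambda>x y. pure_sq A R i x (y \<otimes>\<^bsub>A\<^esub> a)) T"

definition tensor_sq_bimod ::
    "'a ring \<Rightarrow> 'r ring \<Rightarrow> ('r \<Rightarrow> 'a) \<Rightarrow> ('s \<Rightarrow> 'a) \<Rightarrow> ('t \<Rightarrow> 'a)
      \<Rightarrow> ('s, ('a \<times> 'a \<Rightarrow>\<^sub>0 int) set, 't) bimod"
  where "tensor_sq_bimod A R i l r =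
    monoid.extend (tensor_sq A R i)
      (bimod.fields (\<lambda>s. lmult_sq A R i (l s)) (\<lambda>T t. rmult_sq A R i T (r t)))"

definition left_depth_three ::
    "'a ring \<Rightarrow> 'b ring \<Rightarrow> 'c ring \<Rightarrow> ('b \<Rightarrow> 'a) \<Rightarrow> ('c \<Rightarrow> 'b) \<Rightarrow> bool"
  where "left_depth_three A B C g f \<longleftrightarrow>
    (\<exists>N>0. iso_to_direct_summand C A
       (tensor_sq_bimod A B g (g \<circ> f) id) (power_bimod A (g \<circ> f) id N))"

definition depth_two :: "'a ring \<Rightarrow> 'c ring \<Rightarrow> ('c \<Rightarrow> 'a) \<Rightarrow> bool"
  where "depth_two A C i \<longleftrightarrow>
    (\<exists>N>0. iso_to_direct_summand A C (tensor_sq_bimod A C i id i) (power_bimod A id i N)) \<and>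
    (\<exists>N>0. iso_to_direct_summand C A (tensor_sq_bimod A C i i id) (power_bimod A i id N))"


section \<open>Centralizer and endomorphism rings\<close>

definition centralizer :: "'a ring \<Rightarrow> 'c ring \<Rightarrow> ('c \<Rightarrow> 'a) \<Rightarrow> 'a set"
  where "centralizer A C i =
    {a \<in> carrier A. \<forall>c \<in> carrier C. a \<otimes>\<^bsub>A\<^esub> i c = i c \<otimes>\<^bsub>A\<^esub> a}"

text \<open>
  Additive endomorphisms are represented by functions that are undefined outside the carrier,
  so that equality of endomorphisms is equality of functions.
\<close>

definition map_ring :: "'a ring \<Rightarrow> ('a \<Rightarrow> 'a) set \<Rightarrow> ('a \<Rightarrow> 'a) ring"
  where "map_ring A H =
    \<lparr>carrier = H, monoid.mult = compose (carrier A), monoid.one = (\<lambda>x \<in> carrier A. x),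
     ring.zero = (\<lambda>x \<in> carrier A. \<zero>\<^bsub>A\<^esub>), ring.add = (\<lambda>h k. \<lambda>x \<in> carrier A. h x \<oplus>\<^bsub>A\<^esub> k x)\<rparr>"

definition End_right :: "'a ring \<Rightarrow> 'b ring \<Rightarrow> ('b \<Rightarrow> 'a) \<Rightarrow> ('a \<Rightarrow> 'a) ring"
  where "End_right A B g = map_ring A
    {h \<in> hom (add_monoid A) (add_monoid A) \<inter> extensional (carrier A).
       \<forall>x \<in> carrier A. \<forall>b \<in> carrier B. h (x \<otimes>\<^bsub>A\<^esub> g b) = h x \<otimes>\<^bsub>A\<^esub> g b}"

definition End_bimod ::
    "'a ring \<Rightarrow> 'c ring \<Rightarrow> ('c \<Rightarrow> 'a) \<Rightarrow> 'b ring \<Rightarrow> ('b \<Rightarrow> 'a) \<Rightarrow> ('a \<Rightarrow> 'a) ring"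
  where "End_bimod A C i B g = map_ring A
    {h \<in> carrier (End_right A B g).
       \<forall>c \<in> carrier C. \<forall>x \<in> carrier A. h (i c \<otimes>\<^bsub>A\<^esub> x) = i c \<otimes>\<^bsub>A\<^esub> h x}"


section \<open>The coproduct on the endomorphism ring of a depth two extension\<close>

definition vleft :: "'a ring \<Rightarrow> 'a \<Rightarrow> ('a \<Rightarrow> 'a) \<Rightarrow> ('a \<Rightarrow> 'a)"
  where "vleft A v \<beta> = (\<lambda>x \<in> carrier A. v \<otimes>\<^bsub>A\<^esub> \<beta> x)"

definition vright :: "'a ring \<Rightarrow> ('a \<Rightarrow> 'a) \<Rightarrow> 'a \<Rightarrow> ('a \<Rightarrow> 'a)"
  where "vright A \<beta> v = (\<lambda>x \<in> carrier A. \<beta> x \<otimes>\<^bsub>A\<^esub> v)"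

abbreviation End_CC :: "'a ring \<Rightarrow> 'c ring \<Rightarrow> ('c \<Rightarrow> 'a) \<Rightarrow> ('a \<Rightarrow> 'a) ring"
  where "End_CC A C i \<equiv> End_bimod A C i C i"

text \<open>\<open>S \<otimes>\<^sub>V J\<close>, for \<open>S\<close> the ring of \<open>C\<close>-\<open>C\<close>-endomorphisms of \<open>A\<close> and \<open>J\<close> a left \<open>V\<close>-submodule of \<open>S\<close>.\<close>

definition S_tensor ::
    "'a ring \<Rightarrow> 'c ring \<Rightarrow> ('c \<Rightarrow> 'a) \<Rightarrow> ('a \<Rightarrow> 'a) set
      \<Rightarrow> ((('a \<Rightarrow> 'a) \<times> ('a \<Rightarrow> 'a) \<Rightarrow>\<^sub>0 int) set) monoid"
  where "S_tensor A C i J =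
    tensor (centralizer A C i) (add_monoid (End_CC A C i)) (vright A)
      (add_monoid (map_ring A J)) (vleft A)"

definition S_pure ::
    "'a ring \<Rightarrow> 'c ring \<Rightarrow> ('c \<Rightarrow> 'a) \<Rightarrow> ('a \<Rightarrow> 'a) set
      \<Rightarrow> ('a \<Rightarrow> 'a) \<Rightarrow> ('a \<Rightarrow> 'a) \<Rightarrow> (('a \<Rightarrow> 'a) \<times> ('a \<Rightarrow> 'a) \<Rightarrow>\<^sub>0 int) set"
  where "S_pure A C i J =
    pure_tensor (centralizer A C i) (add_monoid (End_CC A C i)) (vright A)
      (add_monoid (map_ring A J)) (vleft A)"

text \<open>The natural map from \<open>S \<otimes>\<^sub>V J\<close> to \<open>S \<otimes>\<^sub>V S\<close>; it is injective when \<open>A | C\<close> is depth two.\<close>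

definition S_incl ::
    "'a ring \<Rightarrow> 'c ring \<Rightarrow> ('c \<Rightarrow> 'a)
      \<Rightarrow> (('a \<Rightarrow> 'a) \<times> ('a \<Rightarrow> 'a) \<Rightarrow>\<^sub>0 int) set \<Rightarrow> (('a \<Rightarrow> 'a) \<times> ('a \<Rightarrow> 'a) \<Rightarrow>\<^sub>0 int) set"
  where "S_incl A C i =
    tensor_lift (S_tensor A C i (carrier (End_CC A C i))) (S_pure A C i (carrier (End_CC A C i)))"

text \<open>
  Right D2 quasibases: \<open>x \<otimes> y = \<Sum>k<n. x \<gamma>\<^sub>k(y) u\<^sub>k\<close> with \<open>\<gamma>\<^sub>k \<in> S\<close> and \<open>u\<^sub>k \<in> (A \<otimes>\<^sub>C A)\<^sup>C\<close>.
\<close>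

definition right_D2_quasibases ::
    "'a ring \<Rightarrow> 'c ring \<Rightarrow> ('c \<Rightarrow> 'a)
      \<Rightarrow> (nat \<times> (nat \<Rightarrow> 'a \<Rightarrow> 'a) \<times> (nat \<Rightarrow> ('a \<times> 'a \<Rightarrow>\<^sub>0 int) set)) set"
  where "right_D2_quasibases A C i = {(n, \<gamma>, u).
    (\<forall>k<n. \<gamma> k \<in> carrier (End_CC A C i)) \<and>
    (\<forall>k<n. u k \<in> carrier (tensor_sq A C i) \<and>
       (\<forall>c \<in> carrier C. lmult_sq A C i (i c) (u k) = rmult_sq A C i (u k) (i c))) \<and>
    (\<forall>x \<in> carrier A. \<forall>y \<in> carrier A.
       pure_sq A C i x y =
         (\<Otimes>\<^bsub>tensor_sq A C i\<^esub>k \<in> {..<n}. lmult_sq A C i (x \<otimes>\<^bsub>A\<^esub> \<gamma> k y) (u k)))}"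

text \<open>\<open>\<beta> \<mapsto> \<Sum>k. \<gamma>\<^sub>k \<otimes> u\<^sub>k\<^sup>1 \<beta>(u\<^sub>k\<^sup>2 -)\<close>; the value does not depend on the chosen quasibases.\<close>

definition coproduct ::
    "'a ring \<Rightarrow> 'c ring \<Rightarrow> ('c \<Rightarrow> 'a) \<Rightarrow> ('a \<Rightarrow> 'a) \<Rightarrow> (('a \<Rightarrow> 'a) \<times> ('a \<Rightarrow> 'a) \<Rightarrow>\<^sub>0 int) set"
  where "coproduct A C i \<beta> =
    the_elem ((\<lambda>(n, \<gamma>, u).
        \<Otimes>\<^bsub>S_tensor A C i (carrier (End_CC A C i))\<^esub>k \<in> {..<n}.
          S_pure A C i (carrier (End_CC A C i)) (\<gamma> k)
            (\<lambda>x \<in> carrier A. tensor_lift (add_monoid A) (\<lambda>p q. p \<otimes>\<^bsub>A\<^esub> \<beta> (q \<otimes>\<^bsub>A\<^esub> x)) (u k)))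
      ` right_D2_quasibases A C i)"


section \<open>Left coideal subrings and smash products\<close>

definition left_coideal_subring ::
    "'a ring \<Rightarrow> 'c ring \<Rightarrow> ('c \<Rightarrow> 'a) \<Rightarrow> ('a \<Rightarrow> 'a) set \<Rightarrow> bool"
  where "left_coideal_subring A C i J \<longleftrightarrow>
    subring J (End_CC A C i) \<and>
    (\<forall>v \<in> centralizer A C i. \<forall>\<beta> \<in> J. vleft A v \<beta> \<in> J) \<and>
    coproduct A C i ` J \<subseteq> S_incl A C i ` carrier (S_tensor A C i J)"

text \<open>The coproduct of \<open>\<alpha> \<in> J\<close>, regarded as an element of \<open>S \<otimes>\<^sub>V J\<close>.\<close>

definition coideal_coproduct ::
    "'a ring \<Rightarrow> 'c ring \<Rightarrow> ('c \<Rightarrow> 'a) \<Rightarrow> ('a \<Rightarrow> 'a) set \<Rightarrow> ('a \<Rightarrow> 'a)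
      \<Rightarrow> (('a \<Rightarrow> 'a) \<times> ('a \<Rightarrow> 'a) \<Rightarrow>\<^sub>0 int) set"
  where "coideal_coproduct A C i J \<alpha> =
    (THE T. T \<in> carrier (S_tensor A C i J) \<and> S_incl A C i T = coproduct A C i \<alpha>)"

definition smash_group ::
    "'a ring \<Rightarrow> 'c ring \<Rightarrow> ('c \<Rightarrow> 'a) \<Rightarrow> ('a \<Rightarrow> 'a) set \<Rightarrow> (('a \<times> ('a \<Rightarrow> 'a) \<Rightarrow>\<^sub>0 int) set) monoid"
  where "smash_group A C i J =
    tensor (centralizer A C i) (add_monoid A) (\<lambda>a v. a \<otimes>\<^bsub>A\<^esub> v) (add_monoid (map_ring A J)) (vleft A)"

definition smash_pure ::
    "'a ring \<Rightarrow> 'c ring \<Rightarrow> ('c \<Rightarrow> 'a) \<Rightarrow> ('a \<Rightarrow> 'a) set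
      \<Rightarrow> 'a \<Rightarrow> ('a \<Rightarrow> 'a) \<Rightarrow> ('a \<times> ('a \<Rightarrow> 'a) \<Rightarrow>\<^sub>0 int) set"
  where "smash_pure A C i J =
    pure_tensor (centralizer A C i) (add_monoid A) (\<lambda>a v. a \<otimes>\<^bsub>A\<^esub> v) (add_monoid (map_ring A J)) (vleft A)"

text \<open>\<open>(a # \<alpha>)(b # \<beta>) = a (\<alpha>\<^sub>1 \<triangleright> b) # \<alpha>\<^sub>2 \<circ> \<beta>\<close>, extended biadditively.\<close>

definition smash_mult ::
    "'a ring \<Rightarrow> 'c ring \<Rightarrow> ('c \<Rightarrow> 'a) \<Rightarrow> ('a \<Rightarrow> 'a) set
      \<Rightarrow> ('a \<times> ('a \<Rightarrow> 'a) \<Rightarrow>\<^sub>0 int) set \<Rightarrow> ('a \<times> ('a \<Rightarrow> 'a) \<Rightarrow>\<^sub>0 int) set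
      \<Rightarrow> ('a \<times> ('a \<Rightarrow> 'a) \<Rightarrow>\<^sub>0 int) set"
  where "smash_mult A C i J T U =
    tensor_lift (smash_group A C i J)
      (\<lambda>a \<alpha>. tensor_lift (smash_group A C i J)
        (\<lambda>b \<beta>. tensor_lift (smash_group A C i J)
          (\<lambda>\<sigma> \<tau>. smash_pure A C i J (a \<otimes>\<^bsub>A\<^esub> \<sigma> b) (compose (carrier A) \<tau> \<beta>))
          (coideal_coproduct A C i J \<alpha>)) U) T"

definition smash_product ::
    "'a ring \<Rightarrow> 'c ring \<Rightarrow> ('c \<Rightarrow> 'a) \<Rightarrow> ('a \<Rightarrow> 'a) set \<Rightarrow> (('a \<times> ('a \<Rightarrow> 'a) \<Rightarrow>\<^sub>0 int) set) ring"
  where "smash_product A C i J =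
    \<lparr>carrier = carrier (smash_group A C i J),
     monoid.mult = smash_mult A C i J,
     monoid.one = smash_pure A C i J \<one>\<^bsub>A\<^esub> (\<lambda>x \<in> carrier A. x),
     ring.zero = \<one>\<^bsub>smash_group A C i J\<^esub>,
     ring.add = monoid.mult (smash_group A C i J)\<rparr>"

end

theory Submission
  imports Defs
begin

text \<open>
  Write \<open>V\<close> for the centralizer of \<open>C\<close> in \<open>A\<close>, \<open>S\<close> for the ring of \<open>C\<close>-\<open>C\<close>-endomorphisms of \<open>A\<close>, and \<open>J\<close> for
  the ring of \<open>C\<close>-\<open>B\<close>-endomorphisms.

  Splitting an embedding of \<open>A \<otimes>\<^sub>B A\<close> into \<open>A\<^sup>N\<close> turns the depth three condition into quasibases:
  maps \<open>\<gamma>\<^sub>k\<close> in \<open>J\<close> and tensors \<open>u\<^sub>k\<close> in \<open>A \<otimes>\<^sub>B A\<close> that commute with \<open>C\<close>, such that \<open>x \<otimes> 1 = \<Sum>k. u\<^sub>k \<gamma>\<^sub>k(x)\<close> for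
  all \<open>x\<close>. Applying \<open>p \<otimes> q \<mapsto> h(p) q\<close> to this identity, for \<open>h\<close> in \<open>End A\<^sub>B\<close>, gives
  \<open>h(x) = \<Sum>k. h(u\<^sub>k\<^sup>1) u\<^sub>k\<^sup>2 \<gamma>\<^sub>k(x)\<close>. So \<open>a # \<alpha> \<mapsto> (x \<mapsto> a \<alpha>(x))\<close> maps \<open>A \<otimes>\<^sub>V J\<close> onto \<open>End A\<^sub>B\<close>.
  For \<open>h\<close> in \<open>J\<close> the coefficients \<open>h(u\<^sub>k\<^sup>1) u\<^sub>k\<^sup>2\<close> lie in \<open>V\<close>, which makes \<open>J\<close> a finitely generated
  projective left \<open>V\<close>-module. Expanding tensors along its dual basis (\<open>tensor_dual_basis\<close>) shows two
  things: the map from \<open>A \<otimes>\<^sub>V J\<close> to \<open>End A\<^sub>B\<close> is also injective (\<open>smash_action_bij\<close>), and an element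
  \<open>\<Sum> \<alpha> \<otimes> \<beta>\<close> of \<open>S \<otimes>\<^sub>V J\<close> is determined by the values \<open>\<Sum> \<alpha>(x) \<beta>(y)\<close> (\<open>S_tensor_eqI\<close>).
  One half of the depth two condition says that the tower \<open>A | C | C\<close> has left depth three, so the
  same statement holds for \<open>S \<otimes>\<^sub>V S\<close>.

  The other half provides the right quasibases in the definition of the coproduct. Any choice of them
  yields an element with values \<open>\<beta>(x y)\<close> (\<open>coproduct_term\<close>). Therefore the coproduct does not
  depend on the choice. If \<open>\<beta>\<close> lies in \<open>J\<close>, so do the right tensor factors \<open>u\<^sup>1 \<beta>(u\<^sup>2 -)\<close>; hence
  \<open>J\<close> is a left coideal, and the coproduct of \<open>\<beta>\<close> has a unique preimage in \<open>S \<otimes>\<^sub>V J\<close>.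

  Finally, \<open>(a # \<alpha>)(b # \<beta>)\<close> acts on \<open>A\<close> as \<open>x \<mapsto> a \<alpha>\<^sub>1(b) \<alpha>\<^sub>2(\<beta>(x)) = a \<alpha>(b \<beta>(x))\<close>, which is the
  composite of the actions of the two factors. As the action is injective, this identity also proves
  that the smash multiplication is well defined (\<open>balanced_reflect\<close>), and the ring axioms are carried
  over from \<open>End A\<^sub>B\<close>.
\<close>

section \<open>The universal property of the tensor product\<close>

lemma in_hom_mult: "h \<in> hom G H \<Longrightarrow> x \<in> carrier G \<Longrightarrow> y \<in> carrier G \<Longrightarrow> h (x \<otimes>\<^bsub>G\<^esub> y) = h x \<otimes>\<^bsub>H\<^esub> h y"
  by (simp add: hom_def)

lemma hom_finprod:
  assumes "h \<in> hom G H" "comm_group G" "comm_group H" "f \<in> I \<rightarrow> carrier G"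
  shows "h (finprod G f I) = finprod H (\<lambda>i. h (f i)) I"
proof -
  interpret G: comm_group G by fact
  interpret H: comm_group H by fact
  interpret gh: group_hom G H h by unfold_locales fact
  show ?thesis
    using assms(4) by (induction I rule: infinite_finite_induct) (auto simp: Pi_def)
qed

definition balanced ::
    "'r set \<Rightarrow> 'm monoid \<Rightarrow> ('m \<Rightarrow> 'r \<Rightarrow> 'm) \<Rightarrow> 'n monoid \<Rightarrow> ('r \<Rightarrow> 'n \<Rightarrow> 'n) \<Rightarrow> 'h monoid
      \<Rightarrow> ('m \<Rightarrow> 'n \<Rightarrow> 'h) \<Rightarrow> bool"
  where "balanced R M ra N la H \<phi> \<longleftrightarrow>
    (\<forall>m \<in> carrier M. \<forall>n \<in> carrier N. \<phi> m n \<in> carrier H) \<and>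
    (\<forall>m \<in> carrier M. \<forall>m' \<in> carrier M. \<forall>n \<in> carrier N. \<phi> (m \<otimes>\<^bsub>M\<^esub> m') n = \<phi> m n \<otimes>\<^bsub>H\<^esub> \<phi> m' n) \<and>
    (\<forall>m \<in> carrier M. \<forall>n \<in> carrier N. \<forall>n' \<in> carrier N. \<phi> m (n \<otimes>\<^bsub>N\<^esub> n') = \<phi> m n \<otimes>\<^bsub>H\<^esub> \<phi> m n') \<and>
    (\<forall>m \<in> carrier M. \<forall>r \<in> R. \<forall>n \<in> carrier N. \<phi> (ra m r) n = \<phi> m (la r n))"

lemma balancedI:
  assumes "\<And>m n. m \<in> carrier M \<Longrightarrow> n \<in> carrier N \<Longrightarrow> \<phi> m n \<in> carrier H"
    and "\<And>m m' n. m \<in> carrier M \<Longrightarrow> m' \<in> carrier M \<Longrightarrow> n \<in> carrier N \<Longrightarrow>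
      \<phi> (m \<otimes>\<^bsub>M\<^esub> m') n = \<phi> m n \<otimes>\<^bsub>H\<^esub> \<phi> m' n"
    and "\<And>m n n'. m \<in> carrier M \<Longrightarrow> n \<in> carrier N \<Longrightarrow> n' \<in> carrier N \<Longrightarrow>
      \<phi> m (n \<otimes>\<^bsub>N\<^esub> n') = \<phi> m n \<otimes>\<^bsub>H\<^esub> \<phi> m n'"
    and "\<And>m r n. m \<in> carrier M \<Longrightarrow> r \<in> R \<Longrightarrow> n \<in> carrier N \<Longrightarrow> \<phi> (ra m r) n = \<phi> m (la r n)"
  shows "balanced R M ra N la H \<phi>"
  using assms unfolding balanced_def by blast

locale tensor_product = M: comm_group M + N: comm_group N
  for M :: "'m monoid" and N :: "'n monoid" +
  fixes R :: "'r set" and ra :: "'m \<Rightarrow> 'r \<Rightarrow> 'm" and la :: "'r \<Rightarrow> 'n \<Rightarrow> 'n"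
  assumes ra_closed: "m \<in> carrier M \<Longrightarrow> r \<in> R \<Longrightarrow> ra m r \<in> carrier M"
    and la_closed: "n \<in> carrier N \<Longrightarrow> r \<in> R \<Longrightarrow> la r n \<in> carrier N"
begin

abbreviation "F \<equiv> free_Abelian_group (carrier M \<times> carrier N)"
abbreviation "K \<equiv> tensor_kernel R M ra N la"
abbreviation "MN \<equiv> tensor R M ra N la"
abbreviation "pure \<equiv> pure_tensor R M ra N la"

sublocale F: comm_group F
  by (rule abelian_free_Abelian_group)

lemma frag_of_closed: "m \<in> carrier M \<Longrightarrow> n \<in> carrier N \<Longrightarrow> frag_of (m, n) \<in> carrier F"
  by simp

lemma frag_add_closed: "x \<in> carrier F \<Longrightarrow> y \<in> carrier F \<Longrightarrow> x + y \<in> carrier F"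
  using keys_add[of x y] by auto

lemma frag_diff_closed: "x \<in> carrier F \<Longrightarrow> y \<in> carrier F \<Longrightarrow> x - y \<in> carrier F"
  using keys_diff[of x y] by auto

lemmas frag_closed = frag_of_closed frag_add_closed frag_diff_closed

lemma kernel_subgroup: "subgroup K F"
  unfolding tensor_kernel_def
  by (rule F.generate_is_subgroup)
     (auto simp: ra_closed la_closed frag_closed simp del: carrier_free_Abelian_group_iff)

lemma kernel_normal: "K \<lhd> F"
  by (simp add: F.normal_iff_subgroup kernel_subgroup)

sublocale MN: comm_group MN
  unfolding tensor_def by (rule F.abelian_FactGroup[OF kernel_subgroup])

lemma carrier_tensor: "carrier MN = {K #>\<^bsub>F\<^esub> c | c. c \<in> carrier F}"
  by (auto simp: tensor_def FactGroup_def RCOSETS_def)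

lemma mult_coset:
  "x \<in> carrier F \<Longrightarrow> y \<in> carrier F \<Longrightarrow> (K #>\<^bsub>F\<^esub> x) \<otimes>\<^bsub>MN\<^esub> (K #>\<^bsub>F\<^esub> y) = K #>\<^bsub>F\<^esub> (x + y)"
  using normal.rcos_sum[OF kernel_normal, of x y] by (simp add: tensor_def FactGroup_def)

lemma coset_eqI:
  assumes "x - y \<in> K" "x \<in> carrier F" "y \<in> carrier F"
  shows "K #>\<^bsub>F\<^esub> x = K #>\<^bsub>F\<^esub> y"
proof -
  have "x = (x - y) \<otimes>\<^bsub>F\<^esub> y" by simp
  then have "x \<in> K #>\<^bsub>F\<^esub> y" using assms(1) unfolding r_coset_def by blast
  then show ?thesis using F.repr_independence[OF _ assms(3) kernel_subgroup] by metis
qed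

lemma pure_closed [simp, intro]: "m \<in> carrier M \<Longrightarrow> n \<in> carrier N \<Longrightarrow> pure m n \<in> carrier MN"
  unfolding carrier_tensor pure_tensor_def by (metis (mono_tags, lifting) CollectI SigmaI frag_of_in_free_Abelian_group)

lemma balanced_pure: "balanced R M ra N la MN pure"
proof (rule balancedI)
  fix m m' n assume *: "m \<in> carrier M" "m' \<in> carrier M" "n \<in> carrier N"
  have "frag_of (m \<otimes>\<^bsub>M\<^esub> m', n) - (frag_of (m, n) + frag_of (m', n)) \<in> K"
    unfolding tensor_kernel_def diff_diff_eq[symmetric] using * by (intro generate.incl) blast
  then show "pure (m \<otimes>\<^bsub>M\<^esub> m') n = pure m n \<otimes>\<^bsub>MN\<^esub> pure m' n"
    unfolding pure_tensor_def using *
    by (subst mult_coset)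
       (simp_all add: coset_eqI frag_closed del: carrier_free_Abelian_group_iff)
next
  fix m n n' assume *: "m \<in> carrier M" "n \<in> carrier N" "n' \<in> carrier N"
  have "frag_of (m, n \<otimes>\<^bsub>N\<^esub> n') - (frag_of (m, n) + frag_of (m, n')) \<in> K"
    unfolding tensor_kernel_def diff_diff_eq[symmetric] using * by (intro generate.incl) blast
  then show "pure m (n \<otimes>\<^bsub>N\<^esub> n') = pure m n \<otimes>\<^bsub>MN\<^esub> pure m n'"
    unfolding pure_tensor_def using *
    by (subst mult_coset)
       (simp_all add: coset_eqI frag_closed del: carrier_free_Abelian_group_iff)
next
  fix m r n assume *: "m \<in> carrier M" "r \<in> R" "n \<in> carrier N"
  have "frag_of (ra m r, n) - frag_of (m, la r n) \<in> K"
    unfolding tensor_kernel_def using * by (intro generate.incl) blast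
  then show "pure (ra m r) n = pure m (la r n)"
    unfolding pure_tensor_def using * by (simp add: coset_eqI ra_closed la_closed frag_closed del: carrier_free_Abelian_group_iff)
qed auto

lemma pure_add_left:
  "m \<in> carrier M \<Longrightarrow> m' \<in> carrier M \<Longrightarrow> n \<in> carrier N \<Longrightarrow>
    pure (m \<otimes>\<^bsub>M\<^esub> m') n = pure m n \<otimes>\<^bsub>MN\<^esub> pure m' n"
  and pure_add_right:
  "m \<in> carrier M \<Longrightarrow> n \<in> carrier N \<Longrightarrow> n' \<in> carrier N \<Longrightarrow>
    pure m (n \<otimes>\<^bsub>N\<^esub> n') = pure m n \<otimes>\<^bsub>MN\<^esub> pure m n'"
  and pure_balanced:
  "m \<in> carrier M \<Longrightarrow> r \<in> R \<Longrightarrow> n \<in> carrier N \<Longrightarrow> pure (ra m r) n = pure m (la r n)"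
  using balanced_pure unfolding balanced_def by blast+

lemma pure_hom_left: "n \<in> carrier N \<Longrightarrow> (\<lambda>m. pure m n) \<in> hom M MN"
  and pure_hom_right: "m \<in> carrier M \<Longrightarrow> pure m \<in> hom N MN"
  by (auto intro!: homI simp: pure_add_left pure_add_right)

lemma pure_one_left: "n \<in> carrier N \<Longrightarrow> pure \<one>\<^bsub>M\<^esub> n = \<one>\<^bsub>MN\<^esub>"
  using hom_one[OF pure_hom_left M.group_axioms MN.group_axioms] .

lemma inv_pure: "m \<in> carrier M \<Longrightarrow> n \<in> carrier N \<Longrightarrow> inv\<^bsub>MN\<^esub> (pure m n) = pure (inv\<^bsub>M\<^esub> m) n"
  by (rule MN.inv_equality) (simp_all add: pure_add_left[symmetric] pure_one_left)

text \<open>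
  No case for inverses is needed, because \<open>- (m \<otimes> n) = (- m) \<otimes> n\<close>: sums of pure tensors
  exhaust the tensor product.
\<close>

lemma tensor_induct [consumes 1, case_names pure mult]:
  assumes "T \<in> carrier MN"
    and pure: "\<And>m n. m \<in> carrier M \<Longrightarrow> n \<in> carrier N \<Longrightarrow> P (pure m n)"
    and mult: "\<And>T U. T \<in> carrier MN \<Longrightarrow> U \<in> carrier MN \<Longrightarrow> P T \<Longrightarrow> P U \<Longrightarrow> P (T \<otimes>\<^bsub>MN\<^esub> U)"
  shows "P T"
proof -
  \<comment> \<open>The induction over formal sums has a case for differences, so inverses are carried along.\<close>
  let ?Q = "\<lambda>c. K #>\<^bsub>F\<^esub> c \<in> carrier MN \<and> P (K #>\<^bsub>F\<^esub> c) \<and> P (inv\<^bsub>MN\<^esub> (K #>\<^bsub>F\<^esub> c))"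
  obtain c where c: "T = K #>\<^bsub>F\<^esub> c" "Poly_Mapping.keys c \<subseteq> carrier M \<times> carrier N"
    using assms(1) unfolding carrier_tensor by auto
  have *: "K #>\<^bsub>F\<^esub> x \<in> carrier MN" if "Poly_Mapping.keys x \<subseteq> carrier M \<times> carrier N" for x
    unfolding carrier_tensor using that by auto
  have "?Q c"
    using c(2)
  proof (rule free_Abelian_group_induct, goal_cases)
    case 1
    have "K #>\<^bsub>F\<^esub> 0 = \<one>\<^bsub>MN\<^esub>"
      using F.coset_mult_one[OF subgroup.subset[OF kernel_subgroup]]
      by (simp add: tensor_def FactGroup_def)
    moreover have "P \<one>\<^bsub>MN\<^esub>"
      using pure[of "\<one>\<^bsub>M\<^esub>" "\<one>\<^bsub>N\<^esub>"] by (simp add: pure_one_left)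
    ultimately show ?case by simp
  next
    case (2 x y)
    have xy: "Poly_Mapping.keys (x - y) \<subseteq> carrier M \<times> carrier N"
      using 2 frag_diff_closed[of x y] by simp
    have "(K #>\<^bsub>F\<^esub> (x - y)) \<otimes>\<^bsub>MN\<^esub> (K #>\<^bsub>F\<^esub> y) = K #>\<^bsub>F\<^esub> x"
      using 2 xy by (subst mult_coset) auto
    then have eq: "K #>\<^bsub>F\<^esub> (x - y) = (K #>\<^bsub>F\<^esub> x) \<otimes>\<^bsub>MN\<^esub> inv\<^bsub>MN\<^esub> (K #>\<^bsub>F\<^esub> y)"
      using *[OF xy] *[of x] *[of y] 2 MN.inv_solve_right by metis
    show ?case
      unfolding eq using 2 *[of x] *[of y]
      by (auto simp: MN.inv_mult intro!: mult)
  next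
    case (3 a)
    then show ?case
      using pure[of "fst a" "snd a"] pure[of "inv\<^bsub>M\<^esub> (fst a)" "snd a"] inv_pure[of "fst a" "snd a"]
        pure_closed[of "fst a" "snd a"]
      by (auto simp: pure_tensor_def)
  qed
  then show ?thesis using c by simp
qed

lemma hom_eqI:
  assumes "h \<in> hom MN H" "k \<in> hom MN H" "T \<in> carrier MN"
    and "\<And>m n. m \<in> carrier M \<Longrightarrow> n \<in> carrier N \<Longrightarrow> h (pure m n) = k (pure m n)"
  shows "h T = k T"
  using assms(3) by (induction rule: tensor_induct) (simp_all add: assms(4) in_hom_mult[OF assms(1)] in_hom_mult[OF assms(2)])

context
  fixes H :: "'h monoid" and \<phi>
  assumes H: "comm_group H" and \<phi>: "balanced R M ra N la H \<phi>"
begin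

interpretation H: comm_group H by (rule H)

abbreviation (input) eval_sum :: "('m \<times> 'n \<Rightarrow>\<^sub>0 int) \<Rightarrow> 'h" where
  "eval_sum c \<equiv> \<Otimes>\<^bsub>H\<^esub>p \<in> Poly_Mapping.keys c. \<phi> (fst p) (snd p) [^]\<^bsub>H\<^esub> Poly_Mapping.lookup c p"

lemma \<phi>_closed: "p \<in> carrier M \<times> carrier N \<Longrightarrow> \<phi> (fst p) (snd p) \<in> carrier H"
  using \<phi> unfolding balanced_def by auto

lemma \<phi>_pow_closed:
  "p \<in> carrier M \<times> carrier N \<Longrightarrow> \<phi> (fst p) (snd p) [^]\<^bsub>H\<^esub> (z :: int) \<in> carrier H"
  by (rule H.int_pow_closed[OF \<phi>_closed])

lemma eval_sum_superset:
  assumes "finite S" "Poly_Mapping.keys c \<subseteq> S" "S \<subseteq> carrier M \<times> carrier N"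
  shows "eval_sum c = (\<Otimes>\<^bsub>H\<^esub>p \<in> S. \<phi> (fst p) (snd p) [^]\<^bsub>H\<^esub> Poly_Mapping.lookup c p)"
proof (rule H.finprod_mono_neutral_cong_left)
  show "\<phi> (fst p) (snd p) [^]\<^bsub>H\<^esub> Poly_Mapping.lookup c p = \<one>\<^bsub>H\<^esub>" if "p \<in> S - Poly_Mapping.keys c" for p
    using that int_pow_0[of H] by (simp add: in_keys_iff)
qed (use assms in \<open>auto intro!: \<phi>_pow_closed simp del: split_paired_All\<close>)

lemma eval_sum_hom: "(\<lambda>c. eval_sum c) \<in> hom F H"
proof (rule homI)
  fix c assume "c \<in> carrier F"
  then show "eval_sum c \<in> carrier H"
    by (intro H.finprod_closed Pi_I \<phi>_pow_closed) auto
next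
  fix c d assume *: "c \<in> carrier F" "d \<in> carrier F"
  let ?S = "Poly_Mapping.keys c \<union> Poly_Mapping.keys d"
  have S: "finite ?S" "?S \<subseteq> carrier M \<times> carrier N" using * by auto
  have "Poly_Mapping.keys (c + d) \<subseteq> ?S" by (rule keys_add)
  then have "eval_sum (c + d) = (\<Otimes>\<^bsub>H\<^esub>p \<in> ?S. \<phi> (fst p) (snd p) [^]\<^bsub>H\<^esub> Poly_Mapping.lookup (c + d) p)"
    using S by (intro eval_sum_superset) auto
  also have "\<dots> = (\<Otimes>\<^bsub>H\<^esub>p \<in> ?S. \<phi> (fst p) (snd p) [^]\<^bsub>H\<^esub> Poly_Mapping.lookup c p
        \<otimes>\<^bsub>H\<^esub> \<phi> (fst p) (snd p) [^]\<^bsub>H\<^esub> Poly_Mapping.lookup d p)"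
  proof (rule H.finprod_cong'[OF refl])
    fix p assume "p \<in> ?S"
    then have "p \<in> carrier M \<times> carrier N" using S(2) by blast
    then show "\<phi> (fst p) (snd p) [^]\<^bsub>H\<^esub> Poly_Mapping.lookup (c + d) p =
        \<phi> (fst p) (snd p) [^]\<^bsub>H\<^esub> Poly_Mapping.lookup c p
        \<otimes>\<^bsub>H\<^esub> \<phi> (fst p) (snd p) [^]\<^bsub>H\<^esub> Poly_Mapping.lookup d p"
      by (simp only: lookup_add H.int_pow_mult \<phi>_closed)
  qed (use S(2) in \<open>blast intro: H.m_closed \<phi>_pow_closed\<close>)
  also have "\<dots> = eval_sum c \<otimes>\<^bsub>H\<^esub> eval_sum d"
    unfolding eval_sum_superset[OF S(1) Un_upper1 S(2)] eval_sum_superset[OF S(1) Un_upper2 S(2)]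
    using S(2) by (intro H.finprod_multf) (blast intro: \<phi>_pow_closed)+
  finally show "eval_sum (c \<otimes>\<^bsub>F\<^esub> d) = eval_sum c \<otimes>\<^bsub>H\<^esub> eval_sum d" by simp
qed

lemma eval_sum_frag_of:
  "m \<in> carrier M \<Longrightarrow> n \<in> carrier N \<Longrightarrow> eval_sum (frag_of (m, n)) = \<phi> m n"
  using \<phi>_closed[of "(m, n)"] by simp

lemma eval_sum_closed: "c \<in> carrier F \<Longrightarrow> eval_sum c \<in> carrier H"
  using hom_in_carrier[OF eval_sum_hom] .

lemma eval_sum_diff:
  assumes "c \<in> carrier F" "d \<in> carrier F"
  shows "eval_sum (c - d) = eval_sum c \<otimes>\<^bsub>H\<^esub> inv\<^bsub>H\<^esub> eval_sum d"
proof -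
  interpret eh: group_hom F H "\<lambda>c. eval_sum c"
    by unfold_locales (rule eval_sum_hom)
  have "c - d = c \<otimes>\<^bsub>F\<^esub> inv\<^bsub>F\<^esub> d" using assms by simp
  then show ?thesis using assms eh.hom_mult eh.hom_inv F.inv_closed by presburger
qed

lemma eval_sum_kernel:
  assumes "c \<in> K"
  shows "eval_sum c = \<one>\<^bsub>H\<^esub>"
proof -
  interpret eh: group_hom F H "\<lambda>c. eval_sum c"
    by unfold_locales (rule eval_sum_hom)
  have *: "eval_sum x = \<one>\<^bsub>H\<^esub>" "x \<in> carrier F" if
   x: "x \<in> {frag_of (m \<otimes>\<^bsub>M\<^esub> m', n) - frag_of (m, n) - frag_of (m', n) | m m' n.
          m \<in> carrier M \<and> m' \<in> carrier M \<and> n \<in> carrier N} \<union>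
       {frag_of (m, n \<otimes>\<^bsub>N\<^esub> n') - frag_of (m, n) - frag_of (m, n') | m n n'.
          m \<in> carrier M \<and> n \<in> carrier N \<and> n' \<in> carrier N} \<union>
       {frag_of (ra m r, n) - frag_of (m, la r n) | m r n.
          m \<in> carrier M \<and> r \<in> R \<and> n \<in> carrier N}" (is "x \<in> ?S") for x
  proof -
    from that show "x \<in> carrier F"
      by (auto simp: ra_closed la_closed frag_closed simp del: carrier_free_Abelian_group_iff)
    have c: "\<phi> m n \<in> carrier H" if "m \<in> carrier M" "n \<in> carrier N" for m n
      using that \<phi> unfolding balanced_def by blast
    consider m m' n where "x = frag_of (m \<otimes>\<^bsub>M\<^esub> m', n) - frag_of (m, n) - frag_of (m', n)"
        "m \<in> carrier M" "m' \<in> carrier M" "n \<in> carrier N"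
      | m n n' where "x = frag_of (m, n \<otimes>\<^bsub>N\<^esub> n') - frag_of (m, n) - frag_of (m, n')"
        "m \<in> carrier M" "n \<in> carrier N" "n' \<in> carrier N"
      | m r n where "x = frag_of (ra m r, n) - frag_of (m, la r n)"
        "m \<in> carrier M" "r \<in> R" "n \<in> carrier N" using x by blast
    then show "eval_sum x = \<one>\<^bsub>H\<^esub>"
    proof cases
      case 1
      then have "eval_sum x = \<phi> (m \<otimes>\<^bsub>M\<^esub> m') n \<otimes>\<^bsub>H\<^esub> inv\<^bsub>H\<^esub> \<phi> m n \<otimes>\<^bsub>H\<^esub> inv\<^bsub>H\<^esub> \<phi> m' n"
        by (simp only: eval_sum_diff eval_sum_frag_of frag_closed M.m_closed)
      moreover have "\<phi> (m \<otimes>\<^bsub>M\<^esub> m') n = \<phi> m n \<otimes>\<^bsub>H\<^esub> \<phi> m' n"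
        using \<phi> 1 unfolding balanced_def by blast
      ultimately show ?thesis using 1 c by (simp add: H.m_assoc H.m_comm[of "\<phi> m n"] H.inv_mult[symmetric])
    next
      case 2
      then have "eval_sum x = \<phi> m (n \<otimes>\<^bsub>N\<^esub> n') \<otimes>\<^bsub>H\<^esub> inv\<^bsub>H\<^esub> \<phi> m n \<otimes>\<^bsub>H\<^esub> inv\<^bsub>H\<^esub> \<phi> m n'"
        by (simp only: eval_sum_diff eval_sum_frag_of frag_closed N.m_closed)
      moreover have "\<phi> m (n \<otimes>\<^bsub>N\<^esub> n') = \<phi> m n \<otimes>\<^bsub>H\<^esub> \<phi> m n'"
        using \<phi> 2 unfolding balanced_def by blast
      ultimately show ?thesis using 2 c by (simp add: H.m_assoc H.m_comm[of "\<phi> m n"] H.inv_mult[symmetric])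
    next
      case 3
      then have "eval_sum x = \<phi> (ra m r) n \<otimes>\<^bsub>H\<^esub> inv\<^bsub>H\<^esub> \<phi> m (la r n)"
        by (simp only: eval_sum_diff eval_sum_frag_of frag_closed ra_closed la_closed)
      moreover have "\<phi> (ra m r) n = \<phi> m (la r n)"
        using \<phi> 3 unfolding balanced_def by blast
      ultimately show ?thesis using 3 c by (simp add: la_closed)
    qed
  qed
  from assms show ?thesis unfolding tensor_kernel_def
  proof (induction rule: generate.induct)
    case one
    show ?case by simp
  next
    case (incl h)
    then show ?case by (rule *)
  next
    case (inv h)
    show ?case unfolding eh.hom_inv[OF *(2)[OF inv]] *(1)[OF inv] by (rule H.inv_one)
  next
    case (eng h1 h2)
    have h: "h1 \<in> carrier F" "h2 \<in> carrier F"
      using subgroup.mem_carrier[OF kernel_subgroup] eng(1,2) unfolding tensor_kernel_def by blast+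
    show ?case unfolding in_hom_mult[OF eval_sum_hom h] eng(3,4) by simp
  qed
qed

text \<open>
  The value of a formal sum under \<open>\<phi>\<close> is the same for all representatives of a tensor, since a
  balanced map sends every defining relation to the identity.
\<close>

lemma tensor_lift_coset:
  assumes "c \<in> carrier F"
  shows "tensor_lift H \<phi> (K #>\<^bsub>F\<^esub> c) = eval_sum c"
proof -
  have "eval_sum d = eval_sum c" if d: "d \<in> K #>\<^bsub>F\<^esub> c" for d
  proof -
    obtain k where k: "k \<in> K" "d = k \<otimes>\<^bsub>F\<^esub> c" using d unfolding r_coset_def by auto
    have "k \<in> carrier F" using k(1) subgroup.mem_carrier[OF kernel_subgroup] by blast
    then have "eval_sum d = eval_sum k \<otimes>\<^bsub>H\<^esub> eval_sum c"
      unfolding k(2) by (rule in_hom_mult[OF eval_sum_hom _ assms])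
    then show ?thesis
      unfolding eval_sum_kernel[OF k(1)] using H.l_one[OF eval_sum_closed[OF assms]] by metis
  qed
  moreover have "c \<in> K #>\<^bsub>F\<^esub> c"
    using F.rcos_self[OF assms kernel_subgroup] .
  ultimately have "(\<lambda>c. eval_sum c) ` (K #>\<^bsub>F\<^esub> c) = {eval_sum c}" by blast
  then show ?thesis unfolding tensor_lift_def by simp
qed

lemma lift_pure: "m \<in> carrier M \<Longrightarrow> n \<in> carrier N \<Longrightarrow> tensor_lift H \<phi> (pure m n) = \<phi> m n"
  unfolding pure_tensor_def using trans[OF tensor_lift_coset[OF frag_of_closed] eval_sum_frag_of] .

lemma lift_hom: "tensor_lift H \<phi> \<in> hom MN H"
proof (rule homI)
  fix T assume "T \<in> carrier MN"
  then show "tensor_lift H \<phi> T \<in> carrier H"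
    unfolding carrier_tensor using tensor_lift_coset eval_sum_closed by auto
next
  fix T U assume "T \<in> carrier MN" "U \<in> carrier MN"
  then obtain c d where *: "T = K #>\<^bsub>F\<^esub> c" "U = K #>\<^bsub>F\<^esub> d" "c \<in> carrier F" "d \<in> carrier F"
    unfolding carrier_tensor by blast
  then have "c + d \<in> carrier F" using F.m_closed by fastforce
  then show "tensor_lift H \<phi> (T \<otimes>\<^bsub>MN\<^esub> U) = tensor_lift H \<phi> T \<otimes>\<^bsub>H\<^esub> tensor_lift H \<phi> U"
    using in_hom_mult[OF eval_sum_hom *(3,4)]
    unfolding *(1,2) mult_coset[OF *(3,4)] by (simp add: tensor_lift_coset * del: carrier_free_Abelian_group_iff)
qed

lemma lift_closed: "T \<in> carrier MN \<Longrightarrow> tensor_lift H \<phi> T \<in> carrier H"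
  using lift_hom by (rule hom_in_carrier)

lemma lift_mult:
  "T \<in> carrier MN \<Longrightarrow> U \<in> carrier MN \<Longrightarrow>
    tensor_lift H \<phi> (T \<otimes>\<^bsub>MN\<^esub> U) = tensor_lift H \<phi> T \<otimes>\<^bsub>H\<^esub> tensor_lift H \<phi> U"
  using lift_hom by (rule in_hom_mult)

end

text \<open>
  If \<open>N\<close> is finitely generated projective over the scalars, with dual basis \<open>w\<^sub>k\<close>, \<open>e\<^sub>k\<close>, then every
  tensor is \<open>\<Sum>k. m\<^sub>k \<otimes> e\<^sub>k\<close> with coefficients \<open>m\<^sub>k\<close> that are the images of the tensor under
  \<open>id \<otimes> w\<^sub>k\<close>. Hence two tensors agree as soon as these images do, which is how
  injectivity of maps out of a tensor product is obtained below.
\<close>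

lemma tensor_dual_basis:
  assumes w: "\<And>k n. k \<in> I \<Longrightarrow> n \<in> carrier N \<Longrightarrow> w k n \<in> R"
    and e: "\<And>k. k \<in> I \<Longrightarrow> e k \<in> carrier N"
    and expand: "\<And>n. n \<in> carrier N \<Longrightarrow> n = (\<Otimes>\<^bsub>N\<^esub>k\<in>I. la (w k n) (e k))"
    and bal: "\<And>k. k \<in> I \<Longrightarrow> balanced R M ra N la M (\<lambda>m n. ra m (w k n))"
    and T: "T \<in> carrier MN"
  shows "T = (\<Otimes>\<^bsub>MN\<^esub>k\<in>I. pure (tensor_lift M (\<lambda>m n. ra m (w k n)) T) (e k))"
  using T
proof (induction rule: tensor_induct)
  case (pure m n)
  have "(\<lambda>k. la (w k n) (e k)) \<in> I \<rightarrow> carrier N"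
    using w e pure la_closed by blast
  then have "pure m n = (\<Otimes>\<^bsub>MN\<^esub>k\<in>I. pure m (la (w k n) (e k)))"
    using hom_finprod[OF pure_hom_right[OF pure(1)] N.comm_group_axioms MN.comm_group_axioms] expand[OF pure(2)]
    by metis
  also have "\<dots> = (\<Otimes>\<^bsub>MN\<^esub>k\<in>I. pure (ra m (w k n)) (e k))"
    using pure w e by (intro MN.finprod_cong') (auto simp: pure_balanced ra_closed)
  also have "\<dots> = (\<Otimes>\<^bsub>MN\<^esub>k\<in>I. pure (tensor_lift M (\<lambda>m n. ra m (w k n)) (pure m n)) (e k))"
    using pure w e
    by (intro MN.finprod_cong') (auto simp: lift_pure[OF M.comm_group_axioms bal] ra_closed
        intro!: pure_closed lift_closed[OF M.comm_group_axioms bal])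
  finally show ?case .
next
  case (mult T U)
  let ?L = "\<lambda>k. tensor_lift M (\<lambda>m n. ra m (w k n))"
  have L: "?L k T \<in> carrier M" "?L k U \<in> carrier M" if "k \<in> I" for k
    using lift_closed[OF M.comm_group_axioms bal[OF that]] mult by auto
  have "(\<Otimes>\<^bsub>MN\<^esub>k\<in>I. pure (?L k (T \<otimes>\<^bsub>MN\<^esub> U)) (e k)) =
      (\<Otimes>\<^bsub>MN\<^esub>k\<in>I. pure (?L k T) (e k) \<otimes>\<^bsub>MN\<^esub> pure (?L k U) (e k))"
    using mult L e
    by (intro MN.finprod_cong') (auto simp: lift_mult[OF M.comm_group_axioms bal] pure_add_left)
  also have "\<dots> = (\<Otimes>\<^bsub>MN\<^esub>k\<in>I. pure (?L k T) (e k)) \<otimes>\<^bsub>MN\<^esub> (\<Otimes>\<^bsub>MN\<^esub>k\<in>I. pure (?L k U) (e k))"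
    using L e by (intro MN.finprod_multf) auto
  also have "\<dots> = T \<otimes>\<^bsub>MN\<^esub> U"
    using mult.IH by simp
  finally show ?case by simp
qed

context
  fixes G :: "'x monoid" and H :: "'y monoid" and H' :: "'z monoid" and \<Phi> \<Psi> \<phi> \<psi>
  assumes G: "comm_group G" and H: "comm_group H"
    and \<Phi>: "\<Phi> \<in> hom G H" and inj: "inj_on \<Phi> (carrier G)"
    and \<Psi>: "\<Psi> \<in> hom H' H" and bal: "balanced R M ra N la H' \<psi>"
    and closed: "\<And>m n. m \<in> carrier M \<Longrightarrow> n \<in> carrier N \<Longrightarrow> \<phi> m n \<in> carrier G"
    and square: "\<And>m n. m \<in> carrier M \<Longrightarrow> n \<in> carrier N \<Longrightarrow> \<Phi> (\<phi> m n) = \<Psi> (\<psi> m n)"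
begin

interpretation G: comm_group G by (rule G)

text \<open>
  If \<open>\<Phi>\<close> is injective, then \<open>\<phi>\<close> inherits balancedness from \<open>\<Phi> \<circ> \<phi>\<close>. The functions that define the
  smash multiplication take values in a tensor product, where equalities are hard to verify
  directly; this reduces them to equalities of endomorphisms.
\<close>

lemma balanced_reflect: "balanced R M ra N la G \<phi>"
proof -
  have \<psi>: "\<psi> m n \<in> carrier H'" if "m \<in> carrier M" "n \<in> carrier N" for m n
    using bal that unfolding balanced_def by blast
  show ?thesis
  proof (rule balancedI)
    fix m m' n assume *: "m \<in> carrier M" "m' \<in> carrier M" "n \<in> carrier N"
    have "\<psi> (m \<otimes>\<^bsub>M\<^esub> m') n = \<psi> m n \<otimes>\<^bsub>H'\<^esub> \<psi> m' n"
      using bal * unfolding balanced_def by blast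
    then have "\<Phi> (\<phi> (m \<otimes>\<^bsub>M\<^esub> m') n) = \<Phi> (\<phi> m n \<otimes>\<^bsub>G\<^esub> \<phi> m' n)"
      using * by (simp add: square in_hom_mult[OF \<Phi>] in_hom_mult[OF \<Psi>] closed \<psi>)
    then show "\<phi> (m \<otimes>\<^bsub>M\<^esub> m') n = \<phi> m n \<otimes>\<^bsub>G\<^esub> \<phi> m' n"
      by (rule inj_onD[OF inj]) (use * in \<open>simp_all add: closed\<close>)
  next
    fix m n n' assume *: "m \<in> carrier M" "n \<in> carrier N" "n' \<in> carrier N"
    have "\<psi> m (n \<otimes>\<^bsub>N\<^esub> n') = \<psi> m n \<otimes>\<^bsub>H'\<^esub> \<psi> m n'"
      using bal * unfolding balanced_def by blast
    then have "\<Phi> (\<phi> m (n \<otimes>\<^bsub>N\<^esub> n')) = \<Phi> (\<phi> m n \<otimes>\<^bsub>G\<^esub> \<phi> m n')"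
      using * by (simp add: square in_hom_mult[OF \<Phi>] in_hom_mult[OF \<Psi>] closed \<psi>)
    then show "\<phi> m (n \<otimes>\<^bsub>N\<^esub> n') = \<phi> m n \<otimes>\<^bsub>G\<^esub> \<phi> m n'"
      by (rule inj_onD[OF inj]) (use * in \<open>simp_all add: closed\<close>)
  next
    fix m r n assume *: "m \<in> carrier M" "r \<in> R" "n \<in> carrier N"
    have "\<psi> (ra m r) n = \<psi> m (la r n)"
      using bal * unfolding balanced_def by blast
    then have "\<Phi> (\<phi> (ra m r) n) = \<Phi> (\<phi> m (la r n))"
      using * by (simp add: square ra_closed la_closed)
    then show "\<phi> (ra m r) n = \<phi> m (la r n)"
      by (rule inj_onD[OF inj]) (use * in \<open>simp_all add: closed ra_closed la_closed\<close>)
  qed (rule closed)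
qed

lemma lift_square:
  assumes H': "comm_group H'" and T: "T \<in> carrier MN"
  shows "\<Phi> (tensor_lift G \<phi> T) = \<Psi> (tensor_lift H' \<psi> T)"
proof -
  have "\<Phi> \<circ> tensor_lift G \<phi> \<in> hom MN H"
    using hom_compose[OF lift_hom[OF G balanced_reflect] \<Phi>] .
  moreover have "\<Psi> \<circ> tensor_lift H' \<psi> \<in> hom MN H"
    using hom_compose[OF lift_hom[OF H' bal] \<Psi>] .
  ultimately have "(\<Phi> \<circ> tensor_lift G \<phi>) T = (\<Psi> \<circ> tensor_lift H' \<psi>) T"
    by (rule hom_eqI[OF _ _ T]) (simp add: lift_pure[OF G balanced_reflect] lift_pure[OF H' bal] square)
  then show ?thesis by simp
qed

end

end

section \<open>Direct summands of powers\<close>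

lemma bimod_homD:
  assumes "h \<in> bimod_hom R S M N"
  shows "h \<in> hom M N"
    and "r \<in> carrier R \<Longrightarrow> m \<in> carrier M \<Longrightarrow> h (lact M r m) = lact N r (h m)"
    and "s \<in> carrier S \<Longrightarrow> m \<in> carrier M \<Longrightarrow> h (ract M m s) = ract N (h m) s"
  using assms by (auto simp: bimod_hom_def)

text \<open>
  The retraction \<open>p\<close> projects \<open>N\<close> onto the summand along its complement and then inverts the
  isomorphism with \<open>M\<close>. It is bilinear because the complement is a subbimodule too.
\<close>

lemma summand_retraction:
  assumes "iso_to_direct_summand R S M N"
    and M: "comm_group M" and N: "comm_group N"
    and lN: "\<And>r. r \<in> carrier R \<Longrightarrow> lact N r \<in> hom N N"
    and rN: "\<And>s. s \<in> carrier S \<Longrightarrow> (\<lambda>n. ract N n s) \<in> hom N N"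
    and lM: "\<And>r m. r \<in> carrier R \<Longrightarrow> m \<in> carrier M \<Longrightarrow> lact M r m \<in> carrier M"
    and rM: "\<And>s m. s \<in> carrier S \<Longrightarrow> m \<in> carrier M \<Longrightarrow> ract M m s \<in> carrier M"
  obtains h p where "h \<in> bimod_hom R S M N" "p \<in> bimod_hom R S N M"
    "\<And>m. m \<in> carrier M \<Longrightarrow> p (h m) = m"
proof -
  interpret M: comm_group M by fact
  interpret N: comm_group N by fact
  from assms(1) obtain P Q h where P: "subbimod R S P N" and Q: "subbimod R S Q N"
    and PQ: "P \<inter> Q = {\<one>\<^bsub>N\<^esub>}" "P <#>\<^bsub>N\<^esub> Q = carrier N"
    and h: "h \<in> bimod_hom R S M (N\<lparr>carrier := P\<rparr>)" and bij: "bij_betw h (carrier M) P"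
    unfolding iso_to_direct_summand_def direct_summand_def by blast
  have sP: "subgroup P N" and sQ: "subgroup Q N" using P Q by (auto simp: subbimod_def)
  have hP: "h m \<in> P" if "m \<in> carrier M" for m using bij that by (auto simp: bij_betw_def)
  have hN: "h m \<in> carrier N" if "m \<in> carrier M" for m using hP[OF that] subgroup.mem_carrier[OF sP] by blast
  have QN: "b \<in> carrier N" if "b \<in> Q" for b using subgroup.mem_carrier[OF sQ that] .
  have h_mult: "h (m \<otimes>\<^bsub>M\<^esub> m') = h m \<otimes>\<^bsub>N\<^esub> h m'" if "m \<in> carrier M" "m' \<in> carrier M" for m m'
    using bimod_homD(1)[OF h] that by (simp add: hom_def)
  have h_hom: "h \<in> bimod_hom R S M N"
    using h hN h_mult by (auto simp: bimod_hom_def hom_def)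
  define p where "p n = (THE m. m \<in> carrier M \<and> (\<exists>b \<in> Q. n = h m \<otimes>\<^bsub>N\<^esub> b))" for n
  \<comment> \<open>Two decompositions of \<open>n\<close> differ by an element of \<open>P \<inter> Q\<close>.\<close>
  have p_eqI: "p n = m" if "m \<in> carrier M" "b \<in> Q" "n = h m \<otimes>\<^bsub>N\<^esub> b" for n m b
    unfolding p_def
  proof (rule the_equality)
    show "m \<in> carrier M \<and> (\<exists>b \<in> Q. n = h m \<otimes>\<^bsub>N\<^esub> b)" using that by blast
  next
    fix m' assume "m' \<in> carrier M \<and> (\<exists>b \<in> Q. n = h m' \<otimes>\<^bsub>N\<^esub> b)"
    then obtain b' where m': "m' \<in> carrier M" "b' \<in> Q" "n = h m' \<otimes>\<^bsub>N\<^esub> b'" by blast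
    have c: "h m \<in> carrier N" "h m' \<in> carrier N" "b \<in> carrier N" "b' \<in> carrier N"
      using that m' hN QN by auto
    have eq: "h m \<otimes>\<^bsub>N\<^esub> b = h m' \<otimes>\<^bsub>N\<^esub> b'" using that m' by simp
    have "inv\<^bsub>N\<^esub> (h m') \<otimes>\<^bsub>N\<^esub> h m = b' \<otimes>\<^bsub>N\<^esub> inv\<^bsub>N\<^esub> b"
    proof -
      have "inv\<^bsub>N\<^esub> (h m') \<otimes>\<^bsub>N\<^esub> h m = inv\<^bsub>N\<^esub> (h m') \<otimes>\<^bsub>N\<^esub> (h m \<otimes>\<^bsub>N\<^esub> b \<otimes>\<^bsub>N\<^esub> inv\<^bsub>N\<^esub> b)"
        using c by (simp add: N.m_assoc)
      also have "\<dots> = inv\<^bsub>N\<^esub> (h m') \<otimes>\<^bsub>N\<^esub> h m' \<otimes>\<^bsub>N\<^esub> (b' \<otimes>\<^bsub>N\<^esub> inv\<^bsub>N\<^esub> b)"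
        unfolding eq using c by (simp only: N.m_assoc N.m_closed N.inv_closed)
      finally show ?thesis using c by simp
    qed
    moreover have "inv\<^bsub>N\<^esub> (h m') \<otimes>\<^bsub>N\<^esub> h m \<in> P"
      using hP that(1) m'(1) sP by (simp add: subgroup.m_closed subgroup.m_inv_closed)
    moreover have "b' \<otimes>\<^bsub>N\<^esub> inv\<^bsub>N\<^esub> b \<in> Q"
      using that(2) m'(2) sQ by (simp add: subgroup.m_closed subgroup.m_inv_closed)
    ultimately have "inv\<^bsub>N\<^esub> (h m') \<otimes>\<^bsub>N\<^esub> h m = \<one>\<^bsub>N\<^esub>" using PQ(1) by auto
    moreover have "h m = h m' \<otimes>\<^bsub>N\<^esub> (inv\<^bsub>N\<^esub> (h m') \<otimes>\<^bsub>N\<^esub> h m)"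
      using c by (simp add: N.m_assoc[symmetric])
    ultimately have "h m = h m'" using c by simp
    then show "m' = m" using bij that(1) m'(1) by (auto simp: bij_betw_def inj_on_def)
  qed
  have split: "\<exists>m b. m \<in> carrier M \<and> b \<in> Q \<and> n = h m \<otimes>\<^bsub>N\<^esub> b" if "n \<in> carrier N" for n
  proof -
    obtain a b where "a \<in> P" "b \<in> Q" "n = a \<otimes>\<^bsub>N\<^esub> b"
      using \<open>n \<in> carrier N\<close> PQ(2) unfolding set_mult_def by blast
    then show ?thesis using bij unfolding bij_betw_def by blast
  qed
  have "p \<in> bimod_hom R S N M"
    unfolding bimod_hom_def
  proof (intro CollectI conjI ballI homI)
    show "p n \<in> carrier M" if "n \<in> carrier N" for n
      using split[OF that] p_eqI by force
    show "p (n \<otimes>\<^bsub>N\<^esub> n') = p n \<otimes>\<^bsub>M\<^esub> p n'" if n: "n \<in> carrier N" "n' \<in> carrier N" for n n'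
    proof -
      obtain m b m' b' where *: "m \<in> carrier M" "b \<in> Q" "n = h m \<otimes>\<^bsub>N\<^esub> b"
        "m' \<in> carrier M" "b' \<in> Q" "n' = h m' \<otimes>\<^bsub>N\<^esub> b'"
        using split[OF n(1)] split[OF n(2)] by blast
      have "n \<otimes>\<^bsub>N\<^esub> n' = h (m \<otimes>\<^bsub>M\<^esub> m') \<otimes>\<^bsub>N\<^esub> (b \<otimes>\<^bsub>N\<^esub> b')"
        using * hN QN by (simp add: h_mult N.m_ac)
      then have "p (n \<otimes>\<^bsub>N\<^esub> n') = m \<otimes>\<^bsub>M\<^esub> m'"
        using * subgroup.m_closed[OF sQ] by (intro p_eqI) auto
      then show ?thesis unfolding p_eqI[OF *(1-3)] p_eqI[OF *(4-6)] .
    qed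
    show "p (lact N r n) = lact M r (p n)" if r: "r \<in> carrier R" and n: "n \<in> carrier N" for r n
    proof -
      obtain m b where *: "m \<in> carrier M" "b \<in> Q" "n = h m \<otimes>\<^bsub>N\<^esub> b" using split[OF n] by blast
      have "lact N r n = h (lact M r m) \<otimes>\<^bsub>N\<^esub> lact N r b"
        using * hN QN in_hom_mult[OF lN[OF r]] bimod_homD(2)[OF h_hom r] by simp
      moreover have "lact N r b \<in> Q" using Q * r unfolding subbimod_def by blast
      ultimately show ?thesis unfolding p_eqI[OF *] using p_eqI[OF lM[OF r *(1)]] by blast
    qed
    show "p (ract N n s) = ract M (p n) s" if s: "s \<in> carrier S" and n: "n \<in> carrier N" for s n
    proof -
      obtain m b where *: "m \<in> carrier M" "b \<in> Q" "n = h m \<otimes>\<^bsub>N\<^esub> b" using split[OF n] by blast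
      have "ract N n s = h (ract M m s) \<otimes>\<^bsub>N\<^esub> ract N b s"
        using * hN QN in_hom_mult[OF rN[OF s]] bimod_homD(3)[OF h_hom s] by simp
      moreover have "ract N b s \<in> Q" using Q * s unfolding subbimod_def by blast
      ultimately show ?thesis unfolding p_eqI[OF *] using p_eqI[OF rM[OF s *(1)]] by blast
    qed
  qed
  moreover have "p (h m) = m" if "m \<in> carrier M" for m
    using that hN subgroup.one_closed[OF sQ] by (intro p_eqI) auto
  ultimately show thesis using that h_hom by blast
qed

lemma comm_group_extend:
  assumes "comm_group G"
  shows "comm_group (monoid.extend G x)"
proof -
  interpret comm_group G by fact
  have *: "carrier (monoid.extend G x) = carrier G" "monoid.mult (monoid.extend G x) = monoid.mult G"
    "\<one>\<^bsub>monoid.extend G x\<^esub> = \<one>\<^bsub>G\<^esub>"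
    by (simp_all add: monoid.extend_def)
  show ?thesis
    by (rule comm_groupI; unfold * )
       (rule m_closed one_closed m_assoc m_comm l_one l_inv_ex; assumption)+
qed

lemma power_bimod_simps [simp]:
  "carrier (power_bimod A l r N) = (\<Pi>\<^sub>E k\<in>{..<N}. carrier A)"
  "f \<otimes>\<^bsub>power_bimod A l r N\<^esub> f' = (\<lambda>k\<in>{..<N}. f k \<oplus>\<^bsub>A\<^esub> f' k)"
  "\<one>\<^bsub>power_bimod A l r N\<^esub> = (\<lambda>k\<in>{..<N}. \<zero>\<^bsub>A\<^esub>)"
  "lact (power_bimod A l r N) x f = (\<lambda>k \<in> {..<N}. l x \<otimes>\<^bsub>A\<^esub> f k)"
  "ract (power_bimod A l r N) f y = (\<lambda>k \<in> {..<N}. f k \<otimes>\<^bsub>A\<^esub> r y)"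
  by (simp_all add: power_bimod_def monoid.extend_def bimod.fields_def product_group_def)

text \<open>
  Tensor products and endomorphism rings are formed over records of type \<open>'a ring\<close>, a type that
  the locale \<^locale>\<open>ring\<close> leaves open.
\<close>

locale plain_ring = ring A for A :: "'a ring" (structure)
begin

lemma comm_group_add: "comm_group (add_monoid A)"
  by (rule a_comm_group)

lemma power_bimod_comm_group: "comm_group (power_bimod A l r N)"
  unfolding power_bimod_def
proof (intro comm_group_extend group.group_comm_groupI product_group)
  fix f f'
  assume "f \<in> carrier (product_group {..<N} (\<lambda>_. add_monoid A))"
    "f' \<in> carrier (product_group {..<N} (\<lambda>_. add_monoid A))"
  then show "f \<otimes>\<^bsub>product_group {..<N} (\<lambda>_. add_monoid A)\<^esub> f' =
      f' \<otimes>\<^bsub>product_group {..<N} (\<lambda>_. add_monoid A)\<^esub> f"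
    by (auto simp: PiE_iff intro!: restrict_ext a_comm)
qed (rule add.is_group)

lemma power_bimod_coordinate: "k < N \<Longrightarrow> (\<lambda>f. f k) \<in> hom (power_bimod A l r N) (add_monoid A)"
  by (auto intro!: homI simp: PiE_iff)

lemma power_bimod_expand:
  assumes "f \<in> carrier (power_bimod A l r N)"
  shows "f = (\<Otimes>\<^bsub>power_bimod A l r N\<^esub>k\<in>{..<N}. (\<lambda>j\<in>{..<N}. if j = k then f k else \<zero>))" (is "f = ?g")
proof -
  interpret P: comm_group "power_bimod A l r N" by (rule power_bimod_comm_group)
  have fk: "f k \<in> carrier A" if "k < N" for k using assms that by auto
  have F: "(\<lambda>k. \<lambda>j\<in>{..<N}. if j = k then f k else \<zero>) \<in> {..<N} \<rightarrow> carrier (power_bimod A l r N)"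
    using fk by auto
  have g: "?g \<in> carrier (power_bimod A l r N)" by (rule P.finprod_closed[OF F])
  have gj: "?g j = f j" if j: "j < N" for j
  proof -
    let ?G = "add_monoid A :: 'a monoid"
    have "?g j = (\<Otimes>\<^bsub>?G\<^esub>k\<in>{..<N}. if j = k then f k else \<one>\<^bsub>?G\<^esub>)"
      using hom_finprod[OF power_bimod_coordinate[OF j] P.comm_group_axioms comm_group_add F] j by (simp cong: if_cong)
    also have "\<dots> = f j"
      using j fk
      by (intro comm_monoid.finprod_singleton[OF comm_group.axioms(1)[OF comm_group_add]]) auto
    finally show ?thesis .
  qed
  show ?thesis
    by (rule PiE_ext[OF assms[unfolded power_bimod_simps(1)] g[unfolded power_bimod_simps(1)]])
       (rule gj[symmetric], simp)
qed

end

section \<open>Tensor squares of ring extensions\<close>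

locale ring_extension = plain_ring A + B: ring B for A (structure) and B :: "'b ring" +
  fixes g :: "'b \<Rightarrow> 'a"
  assumes g: "g \<in> ring_hom B A"
begin

lemma g_closed [simp]: "b \<in> carrier B \<Longrightarrow> g b \<in> carrier A"
  using ring_hom_closed[OF g] .

sublocale Sq: tensor_product "add_monoid A" "add_monoid A" "carrier B"
    "\<lambda>x b. x \<otimes> g b" "\<lambda>b x. g b \<otimes> x"
  rewrites "tensor (carrier B) (add_monoid A) (\<lambda>x b. x \<otimes> g b) (add_monoid A) (\<lambda>b x. g b \<otimes> x) = tensor_sq A B g"
    and "pure_tensor (carrier B) (add_monoid A) (\<lambda>x b. x \<otimes> g b) (add_monoid A) (\<lambda>b x. g b \<otimes> x) = pure_sq A B g"
    and "carrier (add_monoid A) = carrier A"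
    and "monoid.mult (add_monoid A) = add A"
  by (intro tensor_product.intro tensor_product_axioms.intro comm_group_add)
     (simp_all add: tensor_sq_def pure_sq_def)

abbreviation "sq \<equiv> tensor_sq A B g"
abbreviation "pair \<equiv> pure_sq A B g"
abbreviation "sq_balanced \<equiv> balanced (carrier B) (add_monoid A) (\<lambda>x b. x \<otimes> g b) (add_monoid A) (\<lambda>b x. g b \<otimes> x)"

lemma sq_balancedI:
  assumes "\<And>x y. x \<in> carrier A \<Longrightarrow> y \<in> carrier A \<Longrightarrow> \<phi> x y \<in> carrier H"
    and "\<And>x x' y. x \<in> carrier A \<Longrightarrow> x' \<in> carrier A \<Longrightarrow> y \<in> carrier A \<Longrightarrow>
      \<phi> (x \<oplus> x') y = \<phi> x y \<otimes>\<^bsub>H\<^esub> \<phi> x' y"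
    and "\<And>x y y'. x \<in> carrier A \<Longrightarrow> y \<in> carrier A \<Longrightarrow> y' \<in> carrier A \<Longrightarrow>
      \<phi> x (y \<oplus> y') = \<phi> x y \<otimes>\<^bsub>H\<^esub> \<phi> x y'"
    and "\<And>x b y. x \<in> carrier A \<Longrightarrow> b \<in> carrier B \<Longrightarrow> y \<in> carrier A \<Longrightarrow>
      \<phi> (x \<otimes> g b) y = \<phi> x (g b \<otimes> y)"
  shows "sq_balanced H \<phi>"
  using assms by (intro balancedI) auto

lemma lmult_balanced:
  assumes "a \<in> carrier A"
  shows "sq_balanced sq (\<lambda>x y. pair (a \<otimes> x) y)"
  using assms
  by (intro sq_balancedI)
     (auto simp: r_distr m_assoc[symmetric] Sq.pure_add_left Sq.pure_add_right Sq.pure_balanced)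

lemma rmult_balanced:
  assumes "a \<in> carrier A"
  shows "sq_balanced sq (\<lambda>x y. pair x (y \<otimes> a))"
  using assms
  by (intro sq_balancedI)
     (auto simp: l_distr m_assoc Sq.pure_add_left Sq.pure_add_right Sq.pure_balanced)

lemma lmult_hom: "a \<in> carrier A \<Longrightarrow> lmult_sq A B g a \<in> hom sq sq"
  unfolding lmult_sq_def by (rule Sq.lift_hom[OF Sq.MN.comm_group_axioms lmult_balanced])

lemma rmult_hom: "a \<in> carrier A \<Longrightarrow> (\<lambda>T. rmult_sq A B g T a) \<in> hom sq sq"
  unfolding rmult_sq_def using Sq.lift_hom[OF Sq.MN.comm_group_axioms rmult_balanced] by simp

lemma lmult_closed [simp]: "a \<in> carrier A \<Longrightarrow> T \<in> carrier sq \<Longrightarrow> lmult_sq A B g a T \<in> carrier sq"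
  using hom_in_carrier[OF lmult_hom] .

lemma rmult_closed [simp]: "a \<in> carrier A \<Longrightarrow> T \<in> carrier sq \<Longrightarrow> rmult_sq A B g T a \<in> carrier sq"
  using hom_in_carrier[OF rmult_hom] .

lemma lmult_pair:
  "a \<in> carrier A \<Longrightarrow> x \<in> carrier A \<Longrightarrow> y \<in> carrier A \<Longrightarrow> lmult_sq A B g a (pair x y) = pair (a \<otimes> x) y"
  unfolding lmult_sq_def using Sq.lift_pure[OF Sq.MN.comm_group_axioms lmult_balanced] by simp

lemma rmult_pair:
  "a \<in> carrier A \<Longrightarrow> x \<in> carrier A \<Longrightarrow> y \<in> carrier A \<Longrightarrow> rmult_sq A B g (pair x y) a = pair x (y \<otimes> a)"
  unfolding rmult_sq_def using Sq.lift_pure[OF Sq.MN.comm_group_axioms rmult_balanced] by simp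

lemma lmult_lmult:
  assumes "a \<in> carrier A" "b \<in> carrier A" "T \<in> carrier sq"
  shows "lmult_sq A B g a (lmult_sq A B g b T) = lmult_sq A B g (a \<otimes> b) T"
  using assms(3) assms(1,2)
  by (induction rule: Sq.tensor_induct)
     (simp_all add: lmult_pair m_assoc in_hom_mult[OF lmult_hom])

lemma tensor_sq_bimod_simps:
  "carrier (tensor_sq_bimod A B g l r) = carrier sq"
  "monoid.mult (tensor_sq_bimod A B g l r) = monoid.mult sq"
  "\<one>\<^bsub>tensor_sq_bimod A B g l r\<^esub> = \<one>\<^bsub>sq\<^esub>"
  "lact (tensor_sq_bimod A B g l r) s T = lmult_sq A B g (l s) T"
  "ract (tensor_sq_bimod A B g l r) T t = rmult_sq A B g T (r t)"
  by (simp_all add: tensor_sq_bimod_def monoid.extend_def bimod.fields_def)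

text \<open>
  A retraction \<open>p\<close> of an embedding \<open>h\<close> of \<open>A \<otimes>\<^sub>B A\<close> into \<open>A\<^sup>N\<close> gives a dual basis: \<open>\<eta>\<^sub>k\<close> is the \<open>k\<close>-th
  coordinate of \<open>h\<close>, and \<open>q\<^sub>k(a)\<close> is the image under \<open>p\<close> of the vector with the single entry \<open>a\<close>
  in place \<open>k\<close>. With \<open>u\<^sub>k = q\<^sub>k(1)\<close>, left linearity of \<open>p\<close> gives \<open>q\<^sub>k(a) = a u\<^sub>k\<close> for left scalars \<open>a\<close>,
  and right linearity gives \<open>q\<^sub>k(a) = u\<^sub>k a\<close> for right scalars \<open>a\<close>. Therefore a scalar that acts
  on both sides commutes with \<open>u\<^sub>k\<close>.
\<close>

lemma tensor_sq_dual_basis: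
  fixes Rl :: "'r ring" and Sr :: "'s ring"
  assumes summand: "iso_to_direct_summand Rl Sr (tensor_sq_bimod A B g l r) (power_bimod A l r N)"
    and l: "\<And>s. s \<in> carrier Rl \<Longrightarrow> l s \<in> carrier A"
    and r: "\<And>t. t \<in> carrier Sr \<Longrightarrow> r t \<in> carrier A"
  obtains u :: "nat \<Rightarrow> ('a \<times> 'a \<Rightarrow>\<^sub>0 int) set" and \<eta> q where
    "\<And>k. k < N \<Longrightarrow> u k \<in> carrier sq"
    "\<And>k. k < N \<Longrightarrow> \<eta> k \<in> hom sq (add_monoid A)"
    "\<And>k s T. k < N \<Longrightarrow> s \<in> carrier Rl \<Longrightarrow> T \<in> carrier sq \<Longrightarrow> \<eta> k (lmult_sq A B g (l s) T) = l s \<otimes> \<eta> k T"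
    "\<And>k t T. k < N \<Longrightarrow> t \<in> carrier Sr \<Longrightarrow> T \<in> carrier sq \<Longrightarrow> \<eta> k (rmult_sq A B g T (r t)) = \<eta> k T \<otimes> r t"
    "\<And>k s. k < N \<Longrightarrow> s \<in> carrier Rl \<Longrightarrow> q k (l s) = lmult_sq A B g (l s) (u k)"
    "\<And>k t. k < N \<Longrightarrow> t \<in> carrier Sr \<Longrightarrow> q k (r t) = rmult_sq A B g (u k) (r t)"
    "\<And>T. T \<in> carrier sq \<Longrightarrow> T = (\<Otimes>\<^bsub>sq\<^esub>k\<in>{..<N}. q k (\<eta> k T))"
proof -
  let ?P = "power_bimod A l r N" and ?T = "tensor_sq_bimod A B g l r"
  have T: "comm_group ?T"
    unfolding tensor_sq_bimod_def by (rule comm_group_extend[OF Sq.MN.comm_group_axioms])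
  have lP: "lact ?P s \<in> hom ?P ?P" if "s \<in> carrier Rl" for s
    using l[OF that] by (intro homI) (auto simp: PiE_iff r_distr intro!: restrict_ext)
  have rP: "(\<lambda>f. ract ?P f t) \<in> hom ?P ?P" if "t \<in> carrier Sr" for t
    using r[OF that] by (intro homI) (auto simp: PiE_iff l_distr intro!: restrict_ext)
  have lT: "lact ?T s T \<in> carrier ?T" if "s \<in> carrier Rl" "T \<in> carrier ?T" for s T
    using that l by (simp add: tensor_sq_bimod_simps)
  have rT: "ract ?T T t \<in> carrier ?T" if "t \<in> carrier Sr" "T \<in> carrier ?T" for t T
    using that r by (simp add: tensor_sq_bimod_simps)
  obtain h p where h: "h \<in> bimod_hom Rl Sr ?T ?P" and p: "p \<in> bimod_hom Rl Sr ?P ?T"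
    and ph: "\<And>T. T \<in> carrier ?T \<Longrightarrow> p (h T) = T"
    using summand_retraction[OF summand T power_bimod_comm_group lP rP lT rT] by metis
  define single where "single k a = (\<lambda>j\<in>{..<N}. if j = k then a else \<zero>)" for k a
  have single: "single k a \<in> carrier ?P" if "a \<in> carrier A" for k a
    using that by (auto simp: single_def)
  have hom_h: "h \<in> hom sq ?P" and hom_p: "p \<in> hom ?P sq"
    using bimod_homD(1)[OF h] bimod_homD(1)[OF p] unfolding hom_def tensor_sq_bimod_simps by auto
  have hc: "h T \<in> carrier ?P" if "T \<in> carrier sq" for T
    using hom_in_carrier[OF hom_h that] .
  show thesis
  proof (rule that[of "\<lambda>k. p (single k \<one>)" "\<lambda>k T. h T k" "\<lambda>k a. p (single k a)"])
    fix k assume k: "k < N"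
    show "p (single k \<one>) \<in> carrier sq"
      using hom_in_carrier[OF hom_p single] by simp
    show "(\<lambda>T. h T k) \<in> hom sq (add_monoid A)"
      using hom_compose[OF hom_h power_bimod_coordinate[OF k]] by (simp add: comp_def)
    show "h (lmult_sq A B g (l s) T) k = l s \<otimes> h T k" if "s \<in> carrier Rl" "T \<in> carrier sq" for s T
      using bimod_homD(2)[OF h that(1), of T] that(2) k by (simp add: tensor_sq_bimod_simps)
    show "h (rmult_sq A B g T (r t)) k = h T k \<otimes> r t" if "t \<in> carrier Sr" "T \<in> carrier sq" for t T
      using bimod_homD(3)[OF h that(1), of T] that(2) k by (simp add: tensor_sq_bimod_simps)
    show "p (single k (l s)) = lmult_sq A B g (l s) (p (single k \<one>))" if s: "s \<in> carrier Rl" for s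
    proof -
      have "single k (l s) = lact ?P s (single k \<one>)"
        using l[OF s] by (auto simp: single_def)
      then show ?thesis using bimod_homD(2)[OF p s single, of \<one> k] by (simp add: tensor_sq_bimod_simps)
    qed
    show "p (single k (r t)) = rmult_sq A B g (p (single k \<one>)) (r t)" if t: "t \<in> carrier Sr" for t
    proof -
      have "single k (r t) = ract ?P (single k \<one>) t"
        using r[OF t] by (auto simp: single_def)
      then show ?thesis using bimod_homD(3)[OF p t single, of \<one> k] by (simp add: tensor_sq_bimod_simps)
    qed
  next
    fix T assume T: "T \<in> carrier sq"
    have "h T = (\<Otimes>\<^bsub>?P\<^esub>k\<in>{..<N}. single k (h T k))"
      using power_bimod_expand[OF hc[OF T]] unfolding single_def .
    then have "p (h T) = (\<Otimes>\<^bsub>sq\<^esub>k\<in>{..<N}. p (single k (h T k)))"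
      using hom_finprod[OF hom_p power_bimod_comm_group Sq.MN.comm_group_axioms,
          of "\<lambda>k. single k (h T k)" "{..<N}"] hc[OF T] single
      by (auto simp: Pi_iff)
    then show "T = (\<Otimes>\<^bsub>sq\<^esub>k\<in>{..<N}. p (single k (h T k)))"
      using ph[of T] T by (simp add: tensor_sq_bimod_simps)
  qed
qed

end

section \<open>Rings of additive maps\<close>

lemma map_ring_simps [simp]:
  "carrier (map_ring A H) = H"
  "h \<otimes>\<^bsub>map_ring A H\<^esub> k = compose (carrier A) h k"
  "\<one>\<^bsub>map_ring A H\<^esub> = (\<lambda>x\<in>carrier A. x)"
  "\<zero>\<^bsub>map_ring A H\<^esub> = (\<lambda>x\<in>carrier A. \<zero>\<^bsub>A\<^esub>)"
  "h \<oplus>\<^bsub>map_ring A H\<^esub> k = (\<lambda>x\<in>carrier A. h x \<oplus>\<^bsub>A\<^esub> k x)"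
  by (simp_all add: map_ring_def)

context plain_ring
begin

definition additive_maps :: "('a \<Rightarrow> 'a) set"
  where "additive_maps = hom (add_monoid A) (add_monoid A) \<inter> extensional (carrier A)"

lemma additive_mapsD:
  assumes "h \<in> additive_maps"
  shows "x \<in> carrier A \<Longrightarrow> h x \<in> carrier A"
    and "x \<in> carrier A \<Longrightarrow> y \<in> carrier A \<Longrightarrow> h (x \<oplus> y) = h x \<oplus> h y"
    and "h \<in> extensional (carrier A)"
  using assms by (auto simp: additive_maps_def hom_def)

lemma additive_mapsI:
  assumes "\<And>x. x \<in> carrier A \<Longrightarrow> h x \<in> carrier A"
    and "\<And>x y. x \<in> carrier A \<Longrightarrow> y \<in> carrier A \<Longrightarrow> h (x \<oplus> y) = h x \<oplus> h y"
    and "h \<in> extensional (carrier A)"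
  shows "h \<in> additive_maps"
  using assms by (auto simp: additive_maps_def hom_def)

lemma additive_maps_ext:
  assumes "h \<in> additive_maps" "k \<in> additive_maps" "\<And>x. x \<in> carrier A \<Longrightarrow> h x = k x"
  shows "h = k"
  using extensionalityI[OF additive_mapsD(3)[OF assms(1)] additive_mapsD(3)[OF assms(2)]] assms(3) .

lemma ring_map_ring:
  assumes H: "H \<subseteq> additive_maps"
    and id: "(\<lambda>x\<in>carrier A. x) \<in> H" and zero: "(\<lambda>x\<in>carrier A. \<zero>) \<in> H"
    and add: "\<And>h k. h \<in> H \<Longrightarrow> k \<in> H \<Longrightarrow> (\<lambda>x\<in>carrier A. h x \<oplus> k x) \<in> H"
    and neg: "\<And>h. h \<in> H \<Longrightarrow> (\<lambda>x\<in>carrier A. \<ominus> h x) \<in> H"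
    and comp: "\<And>h k. h \<in> H \<Longrightarrow> k \<in> H \<Longrightarrow> compose (carrier A) h k \<in> H"
  shows "ring (map_ring A H)"
proof -
  have c: "h x \<in> carrier A" if "h \<in> H" "x \<in> carrier A" for h x
    using that H additive_mapsD(1) by blast
  have a: "h (x \<oplus> y) = h x \<oplus> h y" if "h \<in> H" "x \<in> carrier A" "y \<in> carrier A" for h x y
    using that H additive_mapsD(2) by blast
  have e: "h \<in> extensional (carrier A)" if "h \<in> H" for h
    using that H additive_mapsD(3) by blast
  have ext: "h = k" if "h \<in> H" "k \<in> H" "\<And>x. x \<in> carrier A \<Longrightarrow> h x = k x" for h k
    using extensionalityI[OF e[OF that(1)] e[OF that(2)] that(3)] .
  show ?thesis
  proof (rule ringI)
    show "abelian_group (map_ring A H)"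
    proof (rule abelian_groupI)
      fix h assume h: "h \<in> carrier (map_ring A H)"
      have "(\<lambda>x\<in>carrier A. \<ominus> h x) \<oplus>\<^bsub>map_ring A H\<^esub> h = \<zero>\<^bsub>map_ring A H\<^esub>"
        using h by (auto simp: c l_neg intro!: restrict_ext)
      then show "\<exists>k\<in>carrier (map_ring A H). k \<oplus>\<^bsub>map_ring A H\<^esub> h = \<zero>\<^bsub>map_ring A H\<^esub>"
        using neg h unfolding map_ring_simps(1) by blast
      show "\<zero>\<^bsub>map_ring A H\<^esub> \<oplus>\<^bsub>map_ring A H\<^esub> h = h"
        using h add[OF zero, of h] by (intro ext) (auto simp: c)
    qed (auto simp: c add zero a_assoc intro!: restrict_ext a_comm)
    show "monoid (map_ring A H)"
    proof (rule monoidI)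
      fix h k l assume "h \<in> carrier (map_ring A H)" "k \<in> carrier (map_ring A H)" "l \<in> carrier (map_ring A H)"
      then show "h \<otimes>\<^bsub>map_ring A H\<^esub> k \<otimes>\<^bsub>map_ring A H\<^esub> l = h \<otimes>\<^bsub>map_ring A H\<^esub> (k \<otimes>\<^bsub>map_ring A H\<^esub> l)"
        by (auto simp: compose_def c intro!: restrict_ext)
    next
      fix h assume h: "h \<in> carrier (map_ring A H)"
      show "\<one>\<^bsub>map_ring A H\<^esub> \<otimes>\<^bsub>map_ring A H\<^esub> h = h"
        using h by (intro ext) (auto simp: comp id compose_eq c)
      show "h \<otimes>\<^bsub>map_ring A H\<^esub> \<one>\<^bsub>map_ring A H\<^esub> = h"
        using h by (intro ext) (auto simp: comp id compose_eq c)
    qed (auto simp: id comp)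
  qed (auto simp: compose_def c a intro!: restrict_ext)
qed

end

section \<open>Right linear and bilinear endomorphisms\<close>

text \<open>
  The map \<open>\<mu> \<circ> (h \<otimes> id)\<close> from \<open>A \<otimes>\<^sub>B A\<close> to \<open>A\<close>, defined when \<open>h\<close> is right \<open>B\<close>-linear. Applied to
  the tensors of a quasibasis it yields the coordinates of \<open>h\<close>.
\<close>

definition (in plain_ring) contract :: "('a \<Rightarrow> 'a) \<Rightarrow> ('a \<times> 'a \<Rightarrow>\<^sub>0 int) set \<Rightarrow> 'a"
  where "contract h = tensor_lift (add_monoid A) (\<lambda>p q. h p \<otimes> q)"

context ring_extension
begin

lemma End_right_iff:
  "h \<in> carrier (End_right A B g) \<longleftrightarrow>
    h \<in> additive_maps \<and> (\<forall>x\<in>carrier A. \<forall>b\<in>carrier B. h (x \<otimes> g b) = h x \<otimes> g b)"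
  by (auto simp: End_right_def additive_maps_def)

lemma End_rightD:
  assumes "h \<in> carrier (End_right A B g)"
  shows "h \<in> additive_maps"
    and "x \<in> carrier A \<Longrightarrow> h x \<in> carrier A"
    and "x \<in> carrier A \<Longrightarrow> y \<in> carrier A \<Longrightarrow> h (x \<oplus> y) = h x \<oplus> h y"
    and "x \<in> carrier A \<Longrightarrow> b \<in> carrier B \<Longrightarrow> h (x \<otimes> g b) = h x \<otimes> g b"
  using assms additive_mapsD unfolding End_right_iff by auto

lemma End_right_simps [simp]:
  "h \<otimes>\<^bsub>End_right A B g\<^esub> k = compose (carrier A) h k"
  "\<one>\<^bsub>End_right A B g\<^esub> = (\<lambda>x\<in>carrier A. x)"
  "\<zero>\<^bsub>End_right A B g\<^esub> = (\<lambda>x\<in>carrier A. \<zero>)"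
  "h \<oplus>\<^bsub>End_right A B g\<^esub> k = (\<lambda>x\<in>carrier A. h x \<oplus> k x)"
  by (simp_all add: End_right_def)

lemma End_right_eqI:
  "h \<in> carrier (End_right A B g) \<Longrightarrow> k \<in> carrier (End_right A B g) \<Longrightarrow>
    (\<And>x. x \<in> carrier A \<Longrightarrow> h x = k x) \<Longrightarrow> h = k"
  using additive_maps_ext End_rightD(1) by blast

lemma a_add_add_comm:
  "x \<in> carrier A \<Longrightarrow> y \<in> carrier A \<Longrightarrow> z \<in> carrier A \<Longrightarrow> w \<in> carrier A \<Longrightarrow>
    (x \<oplus> y) \<oplus> (z \<oplus> w) = (x \<oplus> z) \<oplus> (y \<oplus> w)"
  by (simp add: a_ac)

lemma End_right_id: "(\<lambda>x\<in>carrier A. x) \<in> carrier (End_right A B g)"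
  by (auto simp: End_right_iff intro!: additive_mapsI)

lemma End_right_zero: "(\<lambda>x\<in>carrier A. \<zero>) \<in> carrier (End_right A B g)"
  by (auto simp: End_right_iff intro!: additive_mapsI)

lemma End_right_add:
  assumes "h \<in> carrier (End_right A B g)" "k \<in> carrier (End_right A B g)"
  shows "(\<lambda>x\<in>carrier A. h x \<oplus> k x) \<in> carrier (End_right A B g)"
  unfolding End_right_iff
  by (auto simp: End_rightD(2-4)[OF assms(1)] End_rightD(2-4)[OF assms(2)] a_add_add_comm l_distr
      intro!: additive_mapsI)

lemma End_right_neg:
  assumes "h \<in> carrier (End_right A B g)"
  shows "(\<lambda>x\<in>carrier A. \<ominus> h x) \<in> carrier (End_right A B g)"
  unfolding End_right_iff
  by (auto simp: End_rightD(2-4)[OF assms(1)] minus_add l_minus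
      intro!: additive_mapsI)

lemma End_right_compose:
  assumes "h \<in> carrier (End_right A B g)" "k \<in> carrier (End_right A B g)"
  shows "compose (carrier A) h k \<in> carrier (End_right A B g)"
  unfolding End_right_iff compose_def
  by (auto simp: End_rightD(2-4)[OF assms(1)] End_rightD(2-4)[OF assms(2)]
      intro!: additive_mapsI)

lemma End_right_vleft:
  assumes "h \<in> carrier (End_right A B g)" "a \<in> carrier A"
  shows "vleft A a h \<in> carrier (End_right A B g)"
  unfolding End_right_iff vleft_def using assms(2)
  by (auto simp: End_rightD(2-4)[OF assms(1)] r_distr m_assoc intro!: additive_mapsI)

lemma ring_End_right: "ring (End_right A B g)"
proof -
  have "End_right A B g = map_ring A (carrier (End_right A B g))"
    by (simp add: End_right_def)
  moreover have "ring (map_ring A (carrier (End_right A B g)))"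
    using End_rightD(1) End_right_id End_right_zero End_right_add End_right_neg End_right_compose
    by (intro ring_map_ring) auto
  ultimately show ?thesis by simp
qed

sublocale ER: ring "End_right A B g"
  by (rule ring_End_right)

lemma comm_group_End_right: "comm_group (add_monoid (End_right A B g))"
  by (rule ER.a_comm_group)

lemma vleft_apply: "x \<in> carrier A \<Longrightarrow> vleft A a h x = a \<otimes> h x"
  by (simp add: vleft_def)

lemma End_right_eval_hom:
  "x \<in> carrier A \<Longrightarrow> (\<lambda>h. h x) \<in> hom (add_monoid (End_right A B g)) (add_monoid A)"
  by (auto intro!: homI simp: End_rightD)

lemma contract_balanced:
  assumes "h \<in> carrier (End_right A B g)"
  shows "sq_balanced (add_monoid A) (\<lambda>p q. h p \<otimes> q)"
  by (rule sq_balancedI) (auto simp: End_rightD(2-4)[OF assms] l_distr r_distr m_assoc)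

lemma contract_hom: "h \<in> carrier (End_right A B g) \<Longrightarrow> contract h \<in> hom sq (add_monoid A)"
  unfolding contract_def by (rule Sq.lift_hom[OF comm_group_add contract_balanced])

lemma contract_closed [simp]:
  "h \<in> carrier (End_right A B g) \<Longrightarrow> T \<in> carrier sq \<Longrightarrow> contract h T \<in> carrier A"
  using hom_in_carrier[OF contract_hom] by fastforce

lemma contract_mult:
  "h \<in> carrier (End_right A B g) \<Longrightarrow> T \<in> carrier sq \<Longrightarrow> U \<in> carrier sq \<Longrightarrow>
    contract h (T \<otimes>\<^bsub>sq\<^esub> U) = contract h T \<oplus> contract h U"
  using in_hom_mult[OF contract_hom] by fastforce

lemma contract_pair:
  "h \<in> carrier (End_right A B g) \<Longrightarrow> x \<in> carrier A \<Longrightarrow> y \<in> carrier A \<Longrightarrow> contract h (pair x y) = h x \<otimes> y"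
  unfolding contract_def by (rule Sq.lift_pure[OF comm_group_add contract_balanced])

lemma contract_rmult:
  assumes "h \<in> carrier (End_right A B g)" "a \<in> carrier A" "T \<in> carrier sq"
  shows "contract h (rmult_sq A B g T a) = contract h T \<otimes> a"
  using assms(3)
proof (induction rule: Sq.tensor_induct)
  case (pure x y)
  then show ?case using assms by (simp add: rmult_pair contract_pair m_assoc End_rightD(2)[OF assms(1)])
next
  case (mult T U)
  then show ?case using assms by (simp add: in_hom_mult[OF rmult_hom] contract_mult l_distr)
qed

lemma contract_vleft:
  assumes "h \<in> carrier (End_right A B g)" "a \<in> carrier A" "T \<in> carrier sq"
  shows "contract (vleft A a h) T = a \<otimes> contract h T"
  using assms(3)
proof (induction rule: Sq.tensor_induct)
  case (pure x y)
  then show ?case using assms End_right_vleft[OF assms(1,2)]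
    by (simp add: contract_pair m_assoc End_rightD(2)[OF assms(1)] vleft_apply)
next
  case (mult T U)
  then show ?case using assms End_right_vleft[OF assms(1,2)] by (simp add: contract_mult r_distr)
qed

lemma contract_add:
  assumes "h \<in> carrier (End_right A B g)" "k \<in> carrier (End_right A B g)" "T \<in> carrier sq"
  shows "contract (\<lambda>x\<in>carrier A. h x \<oplus> k x) T = contract h T \<oplus> contract k T"
proof -
  define l where "l = (\<lambda>x\<in>carrier A. h x \<oplus> k x)"
  have l: "l \<in> carrier (End_right A B g)" "\<And>x. x \<in> carrier A \<Longrightarrow> l x = h x \<oplus> k x"
    unfolding l_def using End_right_add[OF assms(1,2)] by auto
  from assms(3) have "contract l T = contract h T \<oplus> contract k T"
  proof (induction rule: Sq.tensor_induct)
    case (pure x y)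
    then show ?case using assms l
      by (simp add: contract_pair l_distr End_rightD(2)[OF assms(1)] End_rightD(2)[OF assms(2)])
  next
    case (mult T U)
    then show ?case using assms l by (simp add: contract_mult a_add_add_comm)
  qed
  then show ?thesis by (simp only: l_def)
qed

end

locale extension_pair = plain_ring A + E: ring_extension A B g + I: ring_extension A C i
  for A (structure) and B :: "'b ring" and g and C :: "'c ring" and i
begin

abbreviation "J \<equiv> carrier (End_bimod A C i B g)"
abbreviation "S \<equiv> carrier (End_CC A C i)"
abbreviation "V \<equiv> centralizer A C i"

lemma J_iff:
  "h \<in> J \<longleftrightarrow> h \<in> carrier (End_right A B g) \<and> (\<forall>c\<in>carrier C. \<forall>x\<in>carrier A. h (i c \<otimes> x) = i c \<otimes> h x)"
  by (simp add: End_bimod_def)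

lemma J_End_right: "h \<in> J \<Longrightarrow> h \<in> carrier (End_right A B g)"
  by (simp add: J_iff)

lemmas JD = E.End_rightD[OF J_End_right]

lemma J_left_linear: "h \<in> J \<Longrightarrow> c \<in> carrier C \<Longrightarrow> x \<in> carrier A \<Longrightarrow> h (i c \<otimes> x) = i c \<otimes> h x"
  by (simp add: J_iff)

lemma J_id: "(\<lambda>x\<in>carrier A. x) \<in> J"
  by (auto simp: J_iff E.End_right_id)

lemma J_zero: "(\<lambda>x\<in>carrier A. \<zero>) \<in> J"
  by (auto simp: J_iff E.End_right_zero)

lemma J_add: "h \<in> J \<Longrightarrow> k \<in> J \<Longrightarrow> (\<lambda>x\<in>carrier A. h x \<oplus> k x) \<in> J"
  using E.End_right_add by (auto simp: J_iff r_distr E.End_rightD(2))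

lemma J_neg: "h \<in> J \<Longrightarrow> (\<lambda>x\<in>carrier A. \<ominus> h x) \<in> J"
  using E.End_right_neg by (auto simp: J_iff r_minus E.End_rightD(2))

lemma J_compose: "h \<in> J \<Longrightarrow> k \<in> J \<Longrightarrow> compose (carrier A) h k \<in> J"
  using E.End_right_compose by (auto simp: J_iff compose_def E.End_rightD(2))

lemma ring_J: "ring (map_ring A J)"
  using JD(1) J_id J_zero J_add J_neg J_compose by (intro ring_map_ring) auto

lemma End_bimod_eq: "End_bimod A C i B g = map_ring A J"
  by (simp add: End_bimod_def)

lemma J_comm_group: "comm_group (add_monoid (map_ring A J))"
  by (rule abelian_group.a_comm_group[OF ring.is_abelian_group[OF ring_J]])

lemma V_closed [simp]: "v \<in> V \<Longrightarrow> v \<in> carrier A"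
  by (simp add: centralizer_def)

lemma V_commutes: "v \<in> V \<Longrightarrow> c \<in> carrier C \<Longrightarrow> v \<otimes> i c = i c \<otimes> v"
  unfolding centralizer_def by blast

lemma vleft_J:
  assumes "v \<in> V" "h \<in> J"
  shows "vleft A v h \<in> J"
proof -
  have "v \<otimes> (i c \<otimes> h x) = i c \<otimes> (v \<otimes> h x)" if "c \<in> carrier C" "x \<in> carrier A" for c x
    using that assms by (simp add: m_assoc[symmetric] V_commutes JD(2))
  then show ?thesis
    using E.End_right_vleft[OF J_End_right[OF assms(2)], of v] assms
    by (auto simp: J_iff vleft_def)
qed

lemma S_iff:
  "h \<in> S \<longleftrightarrow> h \<in> carrier (End_right A C i) \<and> (\<forall>c\<in>carrier C. \<forall>x\<in>carrier A. h (i c \<otimes> x) = i c \<otimes> h x)"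
  by (simp add: End_bimod_def)

lemma S_closed: "h \<in> S \<Longrightarrow> x \<in> carrier A \<Longrightarrow> h x \<in> carrier A"
  using I.End_rightD(2) by (simp add: S_iff)

lemma vright_S:
  assumes "v \<in> V" "h \<in> S"
  shows "vright A h v \<in> S"
proof -
  have h: "h \<in> carrier (End_right A C i)" using assms(2) by (simp add: S_iff)
  have "h x \<otimes> i c \<otimes> v = h x \<otimes> v \<otimes> i c" if "c \<in> carrier C" "x \<in> carrier A" for c x
    using that assms I.End_rightD(2)[OF h] by (simp add: m_assoc V_commutes)
  moreover have "h (i c \<otimes> x) = i c \<otimes> h x" if "c \<in> carrier C" "x \<in> carrier A" for c x
    using assms(2) that by (simp add: S_iff)
  ultimately show ?thesis
    using assms by (auto simp: S_iff I.End_right_iff vright_def I.End_rightD(2-4)[OF h] l_distr m_assoc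
        intro!: additive_mapsI)
qed

lemma S_comm_group: "comm_group (add_monoid (End_CC A C i))"
proof -
  interpret CC: extension_pair A C i C i by unfold_locales
  show ?thesis using CC.J_comm_group by (simp only: CC.End_bimod_eq[symmetric])
qed

sublocale SJ: tensor_product "add_monoid (End_CC A C i)" "add_monoid (map_ring A J)" V "vright A" "vleft A"
  rewrites "tensor V (add_monoid (End_CC A C i)) (vright A) (add_monoid (map_ring A J)) (vleft A) = S_tensor A C i J"
    and "pure_tensor V (add_monoid (End_CC A C i)) (vright A) (add_monoid (map_ring A J)) (vleft A) = S_pure A C i J"
    and "carrier (add_monoid (End_CC A C i)) = S"
    and "carrier (add_monoid (map_ring A J)) = J"
  by (intro tensor_product.intro tensor_product_axioms.intro J_comm_group S_comm_group)
     (simp_all add: S_tensor_def S_pure_def vleft_J vright_S)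

sublocale Sm: tensor_product "add_monoid A" "add_monoid (map_ring A J)" V "\<lambda>a v. a \<otimes> v" "vleft A"
  rewrites "tensor V (add_monoid A) (\<lambda>a v. a \<otimes> v) (add_monoid (map_ring A J)) (vleft A) = smash_group A C i J"
    and "pure_tensor V (add_monoid A) (\<lambda>a v. a \<otimes> v) (add_monoid (map_ring A J)) (vleft A) = smash_pure A C i J"
    and "carrier (add_monoid A) = carrier A"
    and "carrier (add_monoid (map_ring A J)) = J"
    and "monoid.mult (add_monoid A) = add A"
  by (intro tensor_product.intro tensor_product_axioms.intro J_comm_group comm_group_add)
     (simp_all add: smash_group_def smash_pure_def vleft_J)

end

section \<open>Evaluating tensors as endomorphisms\<close>

context extension_pair
begin

abbreviation "End_AB \<equiv> End_right A B g"

lemma vleft_add_left: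
  "h \<in> carrier End_AB \<Longrightarrow> a \<in> carrier A \<Longrightarrow> b \<in> carrier A \<Longrightarrow>
    vleft A (a \<oplus> b) h = vleft A a h \<oplus>\<^bsub>End_AB\<^esub> vleft A b h"
  by (auto simp: vleft_def l_distr E.End_rightD(2) intro!: restrict_ext)

lemma vleft_add_right:
  "h \<in> carrier End_AB \<Longrightarrow> k \<in> carrier End_AB \<Longrightarrow> a \<in> carrier A \<Longrightarrow>
    vleft A a (h \<oplus>\<^bsub>End_AB\<^esub> k) = vleft A a h \<oplus>\<^bsub>End_AB\<^esub> vleft A a k"
  by (auto simp: vleft_def r_distr E.End_rightD(2) intro!: restrict_ext)

lemma vleft_vleft:
  "h \<in> carrier End_AB \<Longrightarrow> a \<in> carrier A \<Longrightarrow> b \<in> carrier A \<Longrightarrow>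
    vleft A a (vleft A b h) = vleft A (a \<otimes> b) h"
  by (auto simp: vleft_def m_assoc E.End_rightD(2) intro!: restrict_ext)

lemma J_add_eq: "\<alpha> \<oplus>\<^bsub>map_ring A J\<^esub> \<beta> = \<alpha> \<oplus>\<^bsub>End_AB\<^esub> \<beta>"
  by simp

lemma S_add_eq: "\<alpha> \<otimes>\<^bsub>add_monoid (End_CC A C i)\<^esub> \<beta> = (\<lambda>x\<in>carrier A. \<alpha> x \<oplus> \<beta> x)"
  by (simp add: End_bimod_def)

text \<open>
  The homomorphism \<open>a # \<alpha> \<mapsto> (x \<mapsto> a \<alpha>(x))\<close> from \<open>A \<otimes>\<^sub>V J\<close> to \<open>End A\<^sub>B\<close>, which will be the isomorphism
  of rings.
\<close>

definition smash_action :: "('a \<times> ('a \<Rightarrow> 'a) \<Rightarrow>\<^sub>0 int) set \<Rightarrow> 'a \<Rightarrow> 'a"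
  where "smash_action = tensor_lift (add_monoid End_AB) (vleft A)"

text \<open>
  For \<open>T = \<Sum> \<alpha> \<otimes> \<beta>\<close> in \<open>S \<otimes>\<^sub>V J\<close>, the map \<open>y \<mapsto> \<Sum> \<alpha>(x) \<beta>(y)\<close>. The first argument is kept fixed because the
  map is then right \<open>B\<close>-linear in \<open>y\<close>, so that it can be contracted with tensors in \<open>A \<otimes>\<^sub>B A\<close>.
\<close>

definition eval_left :: "'a \<Rightarrow> (('a \<Rightarrow> 'a) \<times> ('a \<Rightarrow> 'a) \<Rightarrow>\<^sub>0 int) set \<Rightarrow> 'a \<Rightarrow> 'a"
  where "eval_left x = tensor_lift (add_monoid End_AB) (\<lambda>\<sigma> \<tau>. vleft A (\<sigma> x) \<tau>)"

lemma smash_action_balanced: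
  "balanced V (add_monoid A) (\<lambda>a v. a \<otimes> v) (add_monoid (map_ring A J)) (vleft A)
    (add_monoid End_AB) (vleft A)"
  by (rule balancedI)
     (simp_all add: vleft_add_left vleft_add_right J_add_eq vleft_vleft J_End_right E.End_right_vleft
       del: E.End_right_simps map_ring_simps(5))

lemma smash_action_hom: "smash_action \<in> hom (smash_group A C i J) (add_monoid End_AB)"
  unfolding smash_action_def by (rule Sm.lift_hom[OF E.comm_group_End_right smash_action_balanced])

lemma smash_action_closed: "T \<in> carrier (smash_group A C i J) \<Longrightarrow> smash_action T \<in> carrier End_AB"
  using hom_in_carrier[OF smash_action_hom] by fastforce

lemma smash_action_add:
  "T \<in> carrier (smash_group A C i J) \<Longrightarrow> U \<in> carrier (smash_group A C i J) \<Longrightarrow>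
    smash_action (T \<otimes>\<^bsub>smash_group A C i J\<^esub> U) = smash_action T \<oplus>\<^bsub>End_AB\<^esub> smash_action U"
  using in_hom_mult[OF smash_action_hom] by (simp del: E.End_right_simps)

lemma smash_action_pure:
  "a \<in> carrier A \<Longrightarrow> \<alpha> \<in> J \<Longrightarrow> smash_action (smash_pure A C i J a \<alpha>) = vleft A a \<alpha>"
  unfolding smash_action_def by (rule Sm.lift_pure[OF E.comm_group_End_right smash_action_balanced])

lemma eval_left_balanced:
  assumes "x \<in> carrier A"
  shows "balanced V (add_monoid (End_CC A C i)) (vright A) (add_monoid (map_ring A J)) (vleft A)
    (add_monoid End_AB) (\<lambda>\<sigma> \<tau>. vleft A (\<sigma> x) \<tau>)"
proof (rule balancedI)
  fix \<sigma> \<sigma>' \<tau>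
  assume "\<sigma> \<in> carrier (add_monoid (End_CC A C i))" "\<sigma>' \<in> carrier (add_monoid (End_CC A C i))"
    "\<tau> \<in> carrier (add_monoid (map_ring A J))"
  then show "vleft A ((\<sigma> \<otimes>\<^bsub>add_monoid (End_CC A C i)\<^esub> \<sigma>') x) \<tau> =
      vleft A (\<sigma> x) \<tau> \<otimes>\<^bsub>add_monoid End_AB\<^esub> vleft A (\<sigma>' x) \<tau>"
    unfolding S_add_eq using assms
    by (simp add: vleft_add_left S_closed J_End_right del: E.End_right_simps)
next
  fix \<sigma> v \<tau>
  assume "\<sigma> \<in> carrier (add_monoid (End_CC A C i))" "v \<in> V" "\<tau> \<in> carrier (add_monoid (map_ring A J))"
  then show "vleft A (vright A \<sigma> v x) \<tau> = vleft A (\<sigma> x) (vleft A v \<tau>)"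
    using assms by (simp add: vleft_vleft S_closed J_End_right vright_def)
qed (simp_all add: vleft_add_right J_add_eq J_End_right E.End_right_vleft S_closed assms
       del: E.End_right_simps map_ring_simps(5))

lemma eval_left_hom:
  "x \<in> carrier A \<Longrightarrow> eval_left x \<in> hom (S_tensor A C i J) (add_monoid End_AB)"
  unfolding eval_left_def by (rule SJ.lift_hom[OF E.comm_group_End_right eval_left_balanced])

lemma eval_left_closed:
  "x \<in> carrier A \<Longrightarrow> T \<in> carrier (S_tensor A C i J) \<Longrightarrow> eval_left x T \<in> carrier End_AB"
  using hom_in_carrier[OF eval_left_hom] by fastforce

lemma eval_left_add:
  "x \<in> carrier A \<Longrightarrow> T \<in> carrier (S_tensor A C i J) \<Longrightarrow> U \<in> carrier (S_tensor A C i J) \<Longrightarrow>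
    eval_left x (T \<otimes>\<^bsub>S_tensor A C i J\<^esub> U) = eval_left x T \<oplus>\<^bsub>End_AB\<^esub> eval_left x U"
  using in_hom_mult[OF eval_left_hom] by (simp del: E.End_right_simps)

lemma eval_left_pure:
  "x \<in> carrier A \<Longrightarrow> \<alpha> \<in> S \<Longrightarrow> \<beta> \<in> J \<Longrightarrow> eval_left x (S_pure A C i J \<alpha> \<beta>) = vleft A (\<alpha> x) \<beta>"
  unfolding eval_left_def using SJ.lift_pure[OF E.comm_group_End_right eval_left_balanced] by simp

lemma contract_lmult:
  assumes "h \<in> J" "c \<in> carrier C" "T \<in> carrier (tensor_sq A B g)"
  shows "contract h (lmult_sq A B g (i c) T) = i c \<otimes> contract h T"
  using assms(3)
proof (induction rule: E.Sq.tensor_induct)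
  case (pure x y)
  then show ?case
    using assms by (simp add: E.lmult_pair E.contract_pair m_assoc J_End_right J_left_linear JD(2))
next
  case (mult T U)
  then show ?case
    using assms by (simp add: in_hom_mult[OF E.lmult_hom] E.contract_mult r_distr J_End_right)
qed

text \<open>
  Both \<open>c h(u\<^sup>1) u\<^sup>2\<close> and \<open>h(u\<^sup>1) u\<^sup>2 c\<close> are contractions, of \<open>c u\<close> and of \<open>u c\<close>.
\<close>

lemma contract_central:
  assumes "h \<in> J" "u \<in> carrier (tensor_sq A B g)"
    and "\<And>c. c \<in> carrier C \<Longrightarrow> lmult_sq A B g (i c) u = rmult_sq A B g u (i c)"
  shows "contract h u \<in> V"
  unfolding centralizer_def
  using contract_lmult[OF assms(1) _ assms(2)] E.contract_rmult[OF J_End_right[OF assms(1)] _ assms(2)]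
    assms J_End_right by auto

end

section \<open>Coordinates with respect to depth three quasibases\<close>

text \<open>
  The left depth three quasibases of the tower. They are all that is retained of the splitting of
  \<open>A \<otimes>\<^sub>B A\<close> in \<open>A\<^sup>N\<close>.
\<close>

locale depth_three_quasibases = extension_pair +
  fixes n :: nat and u :: "nat \<Rightarrow> ('a \<times> 'a \<Rightarrow>\<^sub>0 int) set" and \<gamma> :: "nat \<Rightarrow> 'a \<Rightarrow> 'a"
  assumes u_closed: "k < n \<Longrightarrow> u k \<in> carrier (tensor_sq A B g)"
    and u_central: "k < n \<Longrightarrow> c \<in> carrier C \<Longrightarrow> lmult_sq A B g (i c) (u k) = rmult_sq A B g (u k) (i c)"
    and \<gamma>_J: "k < n \<Longrightarrow> \<gamma> k \<in> J"
    and quasibasis: "x \<in> carrier A \<Longrightarrow>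
      pure_sq A B g x \<one> = (\<Otimes>\<^bsub>tensor_sq A B g\<^esub>k\<in>{..<n}. rmult_sq A B g (u k) (\<gamma> k x))"
begin

lemma contract_u_closed: "h \<in> carrier End_AB \<Longrightarrow> k < n \<Longrightarrow> contract h (u k) \<in> carrier A"
  using u_closed by simp

lemma contract_u_central: "h \<in> J \<Longrightarrow> k < n \<Longrightarrow> contract h (u k) \<in> V"
  using contract_central u_closed u_central by blast

text \<open>
  Contract \<open>x \<otimes> 1 = \<Sum>k<n. u\<^sub>k \<gamma>\<^sub>k(x)\<close> with \<open>h\<close>.
\<close>

lemma End_right_expand_at:
  assumes h: "h \<in> carrier End_AB" and x: "x \<in> carrier A"
  shows "h x = (\<Otimes>\<^bsub>add_monoid A\<^esub>k\<in>{..<n}. contract h (u k) \<otimes> \<gamma> k x)"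
proof -
  have g: "\<gamma> k x \<in> carrier A" if "k < n" for k using JD(2)[OF \<gamma>_J[OF that] x] .
  have "h x = contract h (pure_sq A B g x \<one>)"
    using E.contract_pair[OF h x one_closed] E.End_rightD(2)[OF h x] by simp
  also have "\<dots> = (\<Otimes>\<^bsub>add_monoid A\<^esub>k\<in>{..<n}. contract h (rmult_sq A B g (u k) (\<gamma> k x)))"
    unfolding quasibasis[OF x] using u_closed g
    by (intro hom_finprod[OF E.contract_hom[OF h] E.Sq.MN.comm_group_axioms comm_group_add]) auto
  also have "\<dots> = (\<Otimes>\<^bsub>add_monoid A\<^esub>k\<in>{..<n}. contract h (u k) \<otimes> \<gamma> k x)"
    using u_closed g h
    by (intro comm_monoid.finprod_cong'[OF comm_group.axioms(1)[OF comm_group_add]])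
       (auto simp: E.contract_rmult)
  finally show ?thesis .
qed

lemma End_right_expand:
  assumes h: "h \<in> carrier End_AB"
  shows "h = (\<Otimes>\<^bsub>add_monoid End_AB\<^esub>k\<in>{..<n}. vleft A (contract h (u k)) (\<gamma> k))" (is "h = ?r")
proof -
  have c: "(\<lambda>k. vleft A (contract h (u k)) (\<gamma> k)) \<in> {..<n} \<rightarrow> carrier (add_monoid End_AB)"
    using E.End_right_vleft J_End_right[OF \<gamma>_J] contract_u_closed[OF h] by auto
  have "?r \<in> carrier (add_monoid End_AB)"
    by (rule comm_monoid.finprod_closed[OF comm_group.axioms(1)[OF E.comm_group_End_right] c])
  then have r: "?r \<in> carrier End_AB" by simp
  show ?thesis
  proof (rule E.End_right_eqI[OF h r])
    fix x assume x: "x \<in> carrier A"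
    have "?r x = (\<Otimes>\<^bsub>add_monoid A\<^esub>k\<in>{..<n}. vleft A (contract h (u k)) (\<gamma> k) x)"
      by (rule hom_finprod[OF E.End_right_eval_hom[OF x] E.comm_group_End_right comm_group_add c])
    then show "h x = ?r x"
      using End_right_expand_at[OF h x] by (simp only: E.vleft_apply[OF x])
  qed
qed

text \<open>
  The coefficients now lie in \<open>V\<close>, so that \<open>J\<close> is a finitely generated projective left
  \<open>V\<close>-module with dual basis \<open>\<alpha> \<mapsto> \<alpha>(u\<^sub>k\<^sup>1) u\<^sub>k\<^sup>2\<close> and \<open>\<gamma>\<^sub>k\<close>.
\<close>

lemma J_expand:
  assumes h: "h \<in> J"
  shows "h = (\<Otimes>\<^bsub>add_monoid (map_ring A J)\<^esub>k\<in>{..<n}. vleft A (contract h (u k)) (\<gamma> k))" (is "h = ?r")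
proof -
  let ?JM = "add_monoid (map_ring A J) :: ('a \<Rightarrow> 'a) monoid"
  have c: "(\<lambda>k. vleft A (contract h (u k)) (\<gamma> k)) \<in> {..<n} \<rightarrow> carrier ?JM"
    using vleft_J \<gamma>_J contract_u_central[OF h] by auto
  have "(\<lambda>h. h) \<in> hom ?JM (add_monoid End_AB :: ('a \<Rightarrow> 'a) monoid)"
    by (auto intro!: homI simp: J_End_right)
  from hom_finprod[OF this J_comm_group E.comm_group_End_right c]
  have "?r = (\<Otimes>\<^bsub>add_monoid End_AB\<^esub>k\<in>{..<n}. vleft A (contract h (u k)) (\<gamma> k))" .
  then show ?thesis using End_right_expand[OF J_End_right[OF h]] by (simp only:)
qed

text \<open>
  The coefficients of the dual basis expansion of \<open>T\<close> depend only on the endomorphism that \<open>T\<close>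
  induces: for \<open>T = a # \<alpha>\<close> the coefficient \<open>a \<alpha>(u\<^sub>k\<^sup>1) u\<^sub>k\<^sup>2\<close> is the contraction of \<open>u\<^sub>k\<close> with
  \<open>x \<mapsto> a \<alpha>(x)\<close>. This makes the induced endomorphism determine \<open>T\<close>.
\<close>

lemma smash_expand:
  assumes T: "T \<in> carrier (smash_group A C i J)"
  shows "T = (\<Otimes>\<^bsub>smash_group A C i J\<^esub>k\<in>{..<n}. smash_pure A C i J (contract (smash_action T) (u k)) (\<gamma> k))"
proof -
  let ?w = "\<lambda>k \<alpha>. contract \<alpha> (u k)"
  have bal: "balanced V (add_monoid A) (\<lambda>a v. a \<otimes> v) (add_monoid (map_ring A J)) (vleft A)
      (add_monoid A) (\<lambda>a \<alpha>. a \<otimes> ?w k \<alpha>)" if k: "k \<in> {..<n}" for k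
    using k by (intro balancedI)
       (auto simp: l_distr r_distr J_End_right contract_u_closed E.contract_add E.contract_vleft u_closed m_assoc)
  have L: "tensor_lift (add_monoid A) (\<lambda>a \<alpha>. a \<otimes> ?w k \<alpha>) T = ?w k (smash_action T)" if k: "k \<in> {..<n}" for k
  proof (rule Sm.hom_eqI[OF Sm.lift_hom[OF comm_group_add bal[OF k]] _ T])
    show "(\<lambda>T. ?w k (smash_action T)) \<in> hom (smash_group A C i J) (add_monoid A)"
      using k by (intro homI)
        (auto simp: smash_action_add smash_action_closed contract_u_closed E.contract_add u_closed)
    show "tensor_lift (add_monoid A) (\<lambda>a \<alpha>. a \<otimes> ?w k \<alpha>) (smash_pure A C i J a \<alpha>) =
        ?w k (smash_action (smash_pure A C i J a \<alpha>))" if "a \<in> carrier A" "\<alpha> \<in> J" for a \<alpha>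
      using that k Sm.lift_pure[OF comm_group_add bal[OF k]]
      by (simp add: smash_action_pure E.contract_vleft J_End_right u_closed)
  qed
  have "T = (\<Otimes>\<^bsub>smash_group A C i J\<^esub>k\<in>{..<n}. smash_pure A C i J (tensor_lift (add_monoid A) (\<lambda>a \<alpha>. a \<otimes> ?w k \<alpha>) T) (\<gamma> k))"
    using contract_u_central \<gamma>_J J_expand bal T by (intro Sm.tensor_dual_basis) auto
  also have "\<dots> = (\<Otimes>\<^bsub>smash_group A C i J\<^esub>k\<in>{..<n}. smash_pure A C i J (?w k (smash_action T)) (\<gamma> k))"
    using L \<gamma>_J contract_u_closed smash_action_closed[OF T]
    by (intro Sm.MN.finprod_cong') auto
  finally show ?thesis .
qed

lemma smash_action_inj: "inj_on smash_action (carrier (smash_group A C i J))"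
proof (rule inj_onI)
  fix T U assume T: "T \<in> carrier (smash_group A C i J)" and U: "U \<in> carrier (smash_group A C i J)"
    and eq: "smash_action T = smash_action U"
  show "T = U" using trans[OF smash_expand[OF T, unfolded eq] smash_expand[OF U, symmetric]] .
qed

lemma smash_action_bij: "bij_betw smash_action (carrier (smash_group A C i J)) (carrier End_AB)"
  unfolding bij_betw_def
proof (intro conjI smash_action_inj subset_antisym image_subsetI smash_action_closed subsetI)
  fix h assume h: "h \<in> carrier End_AB"
  let ?T = "\<Otimes>\<^bsub>smash_group A C i J\<^esub>k\<in>{..<n}. smash_pure A C i J (contract h (u k)) (\<gamma> k)"
  have c: "(\<lambda>k. smash_pure A C i J (contract h (u k)) (\<gamma> k)) \<in> {..<n} \<rightarrow> carrier (smash_group A C i J)"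
    using contract_u_closed[OF h] \<gamma>_J by auto
  have "smash_action ?T =
      (\<Otimes>\<^bsub>add_monoid End_AB\<^esub>k\<in>{..<n}. smash_action (smash_pure A C i J (contract h (u k)) (\<gamma> k)))"
    by (rule hom_finprod[OF smash_action_hom Sm.MN.comm_group_axioms E.comm_group_End_right c])
  also have "\<dots> = (\<Otimes>\<^bsub>add_monoid End_AB\<^esub>k\<in>{..<n}. vleft A (contract h (u k)) (\<gamma> k))"
    using contract_u_closed[OF h] \<gamma>_J
    by (intro comm_monoid.finprod_cong'[OF comm_group.axioms(1)[OF E.comm_group_End_right]])
       (auto simp: smash_action_pure E.End_right_vleft J_End_right)
  also have "\<dots> = h" by (rule End_right_expand[OF h, symmetric])
  finally have eq: "smash_action ?T = h" .
  show "h \<in> smash_action ` carrier (smash_group A C i J)"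
    using imageI[OF Sm.MN.finprod_closed[OF c], of smash_action] by (simp only: eq)
qed

text \<open>
  An element of \<open>S \<otimes>\<^sub>V J\<close> is determined by the biadditive map \<open>(x, y) \<mapsto> \<Sum> \<alpha>(x) \<beta>(y)\<close>: the value at
  \<open>x\<close> of the \<open>k\<close>-th coefficient \<open>\<Sum> \<alpha> \<beta>(u\<^sub>k\<^sup>1) u\<^sub>k\<^sup>2\<close> is the contraction of \<open>u\<^sub>k\<close> with \<open>y \<mapsto> \<Sum> \<alpha>(x) \<beta>(y)\<close>.
\<close>

lemma S_tensor_eqI:
  assumes T: "T \<in> carrier (S_tensor A C i J)" and U: "U \<in> carrier (S_tensor A C i J)"
    and eq: "\<And>x. x \<in> carrier A \<Longrightarrow> eval_left x T = eval_left x U"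
  shows "T = U"
proof -
  let ?w = "\<lambda>k \<alpha>. contract \<alpha> (u k)"
  let ?SM = "add_monoid (End_CC A C i) :: ('a \<Rightarrow> 'a) monoid"
  let ?L = "\<lambda>k. tensor_lift ?SM (\<lambda>\<sigma> \<alpha>. vright A \<sigma> (?w k \<alpha>))"
  have bal: "balanced V ?SM (vright A) (add_monoid (map_ring A J)) (vleft A)
      ?SM (\<lambda>\<sigma> \<alpha>. vright A \<sigma> (?w k \<alpha>))" if k: "k \<in> {..<n}" for k
  proof (rule balancedI)
    fix \<sigma> \<alpha> assume "\<sigma> \<in> carrier ?SM" "\<alpha> \<in> carrier (add_monoid (map_ring A J))"
    then show "vright A \<sigma> (?w k \<alpha>) \<in> carrier ?SM"
      using k by (simp add: vright_S contract_u_central)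
  next
    fix \<sigma> \<sigma>' \<alpha> assume "\<sigma> \<in> carrier ?SM" "\<sigma>' \<in> carrier ?SM" "\<alpha> \<in> carrier (add_monoid (map_ring A J))"
    then show "vright A (\<sigma> \<otimes>\<^bsub>?SM\<^esub> \<sigma>') (?w k \<alpha>) = vright A \<sigma> (?w k \<alpha>) \<otimes>\<^bsub>?SM\<^esub> vright A \<sigma>' (?w k \<alpha>)"
      unfolding S_add_eq using k
      by (auto simp: vright_def l_distr S_closed contract_u_closed J_End_right intro!: restrict_ext)
  next
    fix \<sigma> \<alpha> \<beta> assume "\<sigma> \<in> carrier ?SM" "\<alpha> \<in> carrier (add_monoid (map_ring A J))"
      "\<beta> \<in> carrier (add_monoid (map_ring A J))"
    then show "vright A \<sigma> (?w k (\<alpha> \<otimes>\<^bsub>add_monoid (map_ring A J)\<^esub> \<beta>)) =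
        vright A \<sigma> (?w k \<alpha>) \<otimes>\<^bsub>?SM\<^esub> vright A \<sigma> (?w k \<beta>)"
      unfolding S_add_eq using k
      by (auto simp: vright_def r_distr S_closed contract_u_closed J_End_right E.contract_add u_closed
          intro!: restrict_ext)
  next
    fix \<sigma> v \<alpha> assume "\<sigma> \<in> carrier ?SM" "v \<in> V" "\<alpha> \<in> carrier (add_monoid (map_ring A J))"
    then show "vright A (vright A \<sigma> v) (?w k \<alpha>) = vright A \<sigma> (?w k (vleft A v \<alpha>))"
      using k by (auto simp: vright_def m_assoc S_closed contract_u_closed J_End_right E.contract_vleft u_closed
          intro!: restrict_ext)
  qed
  have L: "?L k T x = ?w k (eval_left x T)"
    if k: "k \<in> {..<n}" and x: "x \<in> carrier A" and T: "T \<in> carrier (S_tensor A C i J)" for k x T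
  proof (rule SJ.hom_eqI[OF _ _ T])
    have "?L k (T \<otimes>\<^bsub>S_tensor A C i J\<^esub> U) = (\<lambda>x\<in>carrier A. ?L k T x \<oplus> ?L k U x)"
      if "T \<in> carrier (S_tensor A C i J)" "U \<in> carrier (S_tensor A C i J)" for T U
      using SJ.lift_mult[OF S_comm_group bal[OF k] that] unfolding S_add_eq .
    then show "(\<lambda>T. ?L k T x) \<in> hom (S_tensor A C i J) (add_monoid A)"
      using SJ.lift_closed[OF S_comm_group bal[OF k]] x by (intro homI) (auto simp: S_closed)
    show "(\<lambda>T. ?w k (eval_left x T)) \<in> hom (S_tensor A C i J) (add_monoid A)"
      using k x by (intro homI)
        (auto simp: eval_left_add eval_left_closed contract_u_closed E.contract_add u_closed)
    show "?L k (S_pure A C i J \<sigma> \<alpha>) x = ?w k (eval_left x (S_pure A C i J \<sigma> \<alpha>))" if "\<sigma> \<in> S" "\<alpha> \<in> J" for \<sigma> \<alpha>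
      using that k x SJ.lift_pure[OF S_comm_group bal[OF k]]
      by (simp add: eval_left_pure E.contract_vleft J_End_right u_closed S_closed vright_def)
  qed
  have expand: "T = (\<Otimes>\<^bsub>S_tensor A C i J\<^esub>k\<in>{..<n}. S_pure A C i J (?L k T) (\<gamma> k))"
    if "T \<in> carrier (S_tensor A C i J)" for T
    using contract_u_central \<gamma>_J J_expand bal that by (intro SJ.tensor_dual_basis) auto
  have "?L k T = ?L k U" if k: "k \<in> {..<n}" for k
  proof -
    have "?L k T \<in> S" "?L k U \<in> S" using SJ.lift_closed[OF S_comm_group bal[OF k]] T U by auto
    then show ?thesis
      using L[OF k _ T] L[OF k _ U] eq by (intro I.End_right_eqI) (auto simp: S_iff)
  qed
  moreover have "?L k U \<in> S" if "k \<in> {..<n}" for k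
    using SJ.lift_closed[OF S_comm_group bal[OF that] U] by simp
  ultimately have "(\<Otimes>\<^bsub>S_tensor A C i J\<^esub>k\<in>{..<n}. S_pure A C i J (?L k T) (\<gamma> k)) =
      (\<Otimes>\<^bsub>S_tensor A C i J\<^esub>k\<in>{..<n}. S_pure A C i J (?L k U) (\<gamma> k))"
    using \<gamma>_J by (intro SJ.MN.finprod_cong') auto
  from trans[OF expand[OF T] trans[OF this expand[OF U, symmetric]]] show ?thesis .
qed

end

section \<open>Existence of quasibases, and the coproduct\<close>

context extension_pair
begin

text \<open>
  As \<open>x \<otimes> y = (x \<otimes> 1) y\<close>, the coordinates of \<open>x \<otimes> 1\<close> are already right \<open>B\<close>-linear in \<open>x\<close>:
  \<open>x b \<otimes> 1 = x \<otimes> b = (x \<otimes> 1) b\<close>.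
\<close>

lemma left_quasibases_exist:
  assumes "iso_to_direct_summand C A (tensor_sq_bimod A B g i id) (power_bimod A i id N)"
  shows "\<exists>u \<gamma>. depth_three_quasibases A B g C i N u \<gamma>"
proof -
  obtain u \<eta> q where u: "\<And>k. k < N \<Longrightarrow> u k \<in> carrier (tensor_sq A B g)"
    and \<eta>_hom: "\<And>k. k < N \<Longrightarrow> \<eta> k \<in> hom (tensor_sq A B g) (add_monoid A)"
    and \<eta>_left: "\<And>k s T. k < N \<Longrightarrow> s \<in> carrier C \<Longrightarrow> T \<in> carrier (tensor_sq A B g) \<Longrightarrow>
      \<eta> k (lmult_sq A B g (i s) T) = i s \<otimes> \<eta> k T"
    and \<eta>_right: "\<And>k t T. k < N \<Longrightarrow> t \<in> carrier A \<Longrightarrow> T \<in> carrier (tensor_sq A B g) \<Longrightarrow>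
      \<eta> k (rmult_sq A B g T (id t)) = \<eta> k T \<otimes> id t"
    and q_left: "\<And>k s. k < N \<Longrightarrow> s \<in> carrier C \<Longrightarrow> q k (i s) = lmult_sq A B g (i s) (u k)"
    and q_right: "\<And>k t. k < N \<Longrightarrow> t \<in> carrier A \<Longrightarrow> q k (id t) = rmult_sq A B g (u k) (id t)"
    and expand: "\<And>T. T \<in> carrier (tensor_sq A B g) \<Longrightarrow>
      T = (\<Otimes>\<^bsub>tensor_sq A B g\<^esub>k\<in>{..<N}. q k (\<eta> k T))"
    by (rule E.tensor_sq_dual_basis[OF assms]) (simp, simp, rule that)
  have \<eta>_closed: "\<eta> k T \<in> carrier A" if "k < N" "T \<in> carrier (tensor_sq A B g)" for k T
    using hom_in_carrier[OF \<eta>_hom[OF that(1)] that(2)] by simp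
  have \<eta>_add: "\<eta> k (T \<otimes>\<^bsub>tensor_sq A B g\<^esub> U) = \<eta> k T \<oplus> \<eta> k U"
    if "k < N" "T \<in> carrier (tensor_sq A B g)" "U \<in> carrier (tensor_sq A B g)" for k T U
    using in_hom_mult[OF \<eta>_hom[OF that(1)] that(2,3)] by simp
  define \<gamma> where "\<gamma> k = (\<lambda>x\<in>carrier A. \<eta> k (pure_sq A B g x \<one>))" for k
  have "depth_three_quasibases A B g C i N u \<gamma>"
  proof (intro depth_three_quasibases.intro depth_three_quasibases_axioms.intro extension_pair_axioms u)
    fix k c assume k: "k < N" and c: "c \<in> carrier C"
    show "lmult_sq A B g (i c) (u k) = rmult_sq A B g (u k) (i c)"
      using q_left[OF k c] q_right[OF k I.g_closed[OF c]] by simp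
  next
    fix k assume k: "k < N"
    have "\<gamma> k (x \<otimes> g b) = \<gamma> k x \<otimes> g b" if "x \<in> carrier A" "b \<in> carrier B" for x b
      using that \<eta>_right[OF k, of "g b" "pure_sq A B g x \<one>"] E.Sq.pure_balanced[of x b \<one>]
      by (simp add: \<gamma>_def E.rmult_pair)
    moreover have "\<gamma> k (i c \<otimes> x) = i c \<otimes> \<gamma> k x" if "x \<in> carrier A" "c \<in> carrier C" for x c
      using that \<eta>_left[OF k, of c "pure_sq A B g x \<one>"] by (simp add: \<gamma>_def E.lmult_pair)
    moreover have "\<gamma> k \<in> additive_maps"
      by (rule additive_mapsI) (simp_all add: \<gamma>_def \<eta>_closed k \<eta>_add E.Sq.pure_add_left)
    ultimately show "\<gamma> k \<in> J" by (auto simp: J_iff E.End_right_iff)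
  next
    fix x assume x: "x \<in> carrier A"
    then have p: "pure_sq A B g x \<one> \<in> carrier (tensor_sq A B g)" by simp
    have "(\<Otimes>\<^bsub>tensor_sq A B g\<^esub>k\<in>{..<N}. q k (\<eta> k (pure_sq A B g x \<one>))) =
        (\<Otimes>\<^bsub>tensor_sq A B g\<^esub>k\<in>{..<N}. rmult_sq A B g (u k) (\<gamma> k x))"
      using x q_right u \<eta>_closed[OF _ p]
      by (intro E.Sq.MN.finprod_cong') (auto simp: \<gamma>_def)
    then show "pure_sq A B g x \<one> = (\<Otimes>\<^bsub>tensor_sq A B g\<^esub>k\<in>{..<N}. rmult_sq A B g (u k) (\<gamma> k x))"
      using trans[OF expand[OF p]] by blast
  qed
  then show ?thesis by blast
qed

text \<open>
  The mirror image, with the coordinates of \<open>1 \<otimes> y\<close>; multiplying by \<open>x\<close> from the left gives the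
  expansion of \<open>x \<otimes> y\<close>.
\<close>

lemma right_quasibases_exist:
  assumes "iso_to_direct_summand A C (tensor_sq_bimod A C i id i) (power_bimod A id i N)"
  shows "right_D2_quasibases A C i \<noteq> {}"
proof -
  obtain u \<eta> q where u: "\<And>k. k < N \<Longrightarrow> u k \<in> carrier (tensor_sq A C i)"
    and \<eta>_hom: "\<And>k. k < N \<Longrightarrow> \<eta> k \<in> hom (tensor_sq A C i) (add_monoid A)"
    and \<eta>_left: "\<And>k s T. k < N \<Longrightarrow> s \<in> carrier A \<Longrightarrow> T \<in> carrier (tensor_sq A C i) \<Longrightarrow>
      \<eta> k (lmult_sq A C i (id s) T) = id s \<otimes> \<eta> k T"
    and \<eta>_right: "\<And>k t T. k < N \<Longrightarrow> t \<in> carrier C \<Longrightarrow> T \<in> carrier (tensor_sq A C i) \<Longrightarrow>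
      \<eta> k (rmult_sq A C i T (i t)) = \<eta> k T \<otimes> i t"
    and q_left: "\<And>k s. k < N \<Longrightarrow> s \<in> carrier A \<Longrightarrow> q k (id s) = lmult_sq A C i (id s) (u k)"
    and q_right: "\<And>k t. k < N \<Longrightarrow> t \<in> carrier C \<Longrightarrow> q k (i t) = rmult_sq A C i (u k) (i t)"
    and expand: "\<And>T. T \<in> carrier (tensor_sq A C i) \<Longrightarrow>
      T = (\<Otimes>\<^bsub>tensor_sq A C i\<^esub>k\<in>{..<N}. q k (\<eta> k T))"
    by (rule I.tensor_sq_dual_basis[OF assms]) (simp, simp, rule that)
  have \<eta>_closed: "\<eta> k T \<in> carrier A" if "k < N" "T \<in> carrier (tensor_sq A C i)" for k T
    using hom_in_carrier[OF \<eta>_hom[OF that(1)] that(2)] by simp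
  have \<eta>_add: "\<eta> k (T \<otimes>\<^bsub>tensor_sq A C i\<^esub> U) = \<eta> k T \<oplus> \<eta> k U"
    if "k < N" "T \<in> carrier (tensor_sq A C i)" "U \<in> carrier (tensor_sq A C i)" for k T U
    using in_hom_mult[OF \<eta>_hom[OF that(1)] that(2,3)] by simp
  define \<gamma> where "\<gamma> k = (\<lambda>y\<in>carrier A. \<eta> k (pure_sq A C i \<one> y))" for k
  have \<gamma>: "\<gamma> k \<in> S" if k: "k < N" for k
  proof -
    have "\<gamma> k (y \<otimes> i c) = \<gamma> k y \<otimes> i c" if "y \<in> carrier A" "c \<in> carrier C" for y c
      using that \<eta>_right[OF k, of c "pure_sq A C i \<one> y"] by (simp add: \<gamma>_def I.rmult_pair)
    moreover have "\<gamma> k (i c \<otimes> y) = i c \<otimes> \<gamma> k y" if "y \<in> carrier A" "c \<in> carrier C" for y c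
      using that \<eta>_left[OF k, of "i c" "pure_sq A C i \<one> y"] I.Sq.pure_balanced[of \<one> c y]
      by (simp add: \<gamma>_def I.lmult_pair)
    moreover have "\<gamma> k \<in> additive_maps"
      by (rule additive_mapsI) (simp_all add: \<gamma>_def \<eta>_closed k \<eta>_add I.Sq.pure_add_right)
    ultimately show ?thesis by (auto simp: S_iff I.End_right_iff)
  qed
  have central: "lmult_sq A C i (i c) (u k) = rmult_sq A C i (u k) (i c)" if "k < N" "c \<in> carrier C" for k c
    using q_left[OF that(1) I.g_closed[OF that(2)]] q_right[OF that] by simp
  have quasibasis: "pure_sq A C i x y = (\<Otimes>\<^bsub>tensor_sq A C i\<^esub>k\<in>{..<N}. lmult_sq A C i (x \<otimes> \<gamma> k y) (u k))"
    if x: "x \<in> carrier A" and y: "y \<in> carrier A" for x y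
  proof -
    have p: "pure_sq A C i \<one> y \<in> carrier (tensor_sq A C i)" using y by simp
    have \<gamma>y: "\<gamma> k y \<in> carrier A" if "k < N" for k using S_closed[OF \<gamma>[OF that] y] .
    have "pure_sq A C i \<one> y = (\<Otimes>\<^bsub>tensor_sq A C i\<^esub>k\<in>{..<N}. lmult_sq A C i (\<gamma> k y) (u k))"
      using trans[OF expand[OF p], of "\<Otimes>\<^bsub>tensor_sq A C i\<^esub>k\<in>{..<N}. lmult_sq A C i (\<gamma> k y) (u k)"]
        I.Sq.MN.finprod_cong'[of "{..<N}" "{..<N}" "\<lambda>k. lmult_sq A C i (\<gamma> k y) (u k)" "\<lambda>k. q k (\<eta> k (pure_sq A C i \<one> y))"]
        y q_left \<eta>_closed[OF _ p] u \<gamma>y by (auto simp: \<gamma>_def)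
    then have "pure_sq A C i x y =
        lmult_sq A C i x (\<Otimes>\<^bsub>tensor_sq A C i\<^esub>k\<in>{..<N}. lmult_sq A C i (\<gamma> k y) (u k))"
      using I.lmult_pair[OF x one_closed y] x by simp
    also have "\<dots> = (\<Otimes>\<^bsub>tensor_sq A C i\<^esub>k\<in>{..<N}. lmult_sq A C i x (lmult_sq A C i (\<gamma> k y) (u k)))"
      using \<gamma>y u
      by (intro hom_finprod[OF I.lmult_hom[OF x] I.Sq.MN.comm_group_axioms I.Sq.MN.comm_group_axioms]) auto
    also have "\<dots> = (\<Otimes>\<^bsub>tensor_sq A C i\<^esub>k\<in>{..<N}. lmult_sq A C i (x \<otimes> \<gamma> k y) (u k))"
      using \<gamma>y u x by (intro I.Sq.MN.finprod_cong') (auto simp: I.lmult_lmult)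
    finally show ?thesis .
  qed
  have "(N, \<gamma>, u) \<in> right_D2_quasibases A C i"
    unfolding right_D2_quasibases_def using \<gamma> u central quasibasis by blast
  then show ?thesis by blast
qed

text \<open>The element \<open>u\<^sup>1 \<beta>(u\<^sup>2 y)\<close> of \<open>A\<close> for \<open>u\<close> in \<open>A \<otimes>\<^sub>C A\<close>.\<close>

definition slide :: "('a \<Rightarrow> 'a) \<Rightarrow> 'a \<Rightarrow> ('a \<times> 'a \<Rightarrow>\<^sub>0 int) set \<Rightarrow> 'a"
  where "slide \<beta> y = tensor_lift (add_monoid A) (\<lambda>p q. p \<otimes> \<beta> (q \<otimes> y))"

lemma slide_balanced:
  assumes "\<beta> \<in> J" "y \<in> carrier A"
  shows "I.sq_balanced (add_monoid A) (\<lambda>p q. p \<otimes> \<beta> (q \<otimes> y))"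
  using assms(2)
  by (intro I.sq_balancedI) (auto simp: JD(2,3)[OF assms(1)] J_left_linear[OF assms(1)] l_distr r_distr m_assoc)

lemma slide_hom: "\<beta> \<in> J \<Longrightarrow> y \<in> carrier A \<Longrightarrow> slide \<beta> y \<in> hom (tensor_sq A C i) (add_monoid A)"
  unfolding slide_def by (rule I.Sq.lift_hom[OF comm_group_add slide_balanced])

lemma slide_closed [simp]:
  "\<beta> \<in> J \<Longrightarrow> y \<in> carrier A \<Longrightarrow> T \<in> carrier (tensor_sq A C i) \<Longrightarrow> slide \<beta> y T \<in> carrier A"
  using hom_in_carrier[OF slide_hom] by fastforce

lemma slide_mult:
  "\<beta> \<in> J \<Longrightarrow> y \<in> carrier A \<Longrightarrow> T \<in> carrier (tensor_sq A C i) \<Longrightarrow> U \<in> carrier (tensor_sq A C i) \<Longrightarrow>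
    slide \<beta> y (T \<otimes>\<^bsub>tensor_sq A C i\<^esub> U) = slide \<beta> y T \<oplus> slide \<beta> y U"
  using in_hom_mult[OF slide_hom] by fastforce

lemma slide_pair:
  "\<beta> \<in> J \<Longrightarrow> y \<in> carrier A \<Longrightarrow> p \<in> carrier A \<Longrightarrow> q \<in> carrier A \<Longrightarrow>
    slide \<beta> y (pure_sq A C i p q) = p \<otimes> \<beta> (q \<otimes> y)"
  unfolding slide_def by (rule I.Sq.lift_pure[OF comm_group_add slide_balanced])

lemma slide_lmult:
  assumes "\<beta> \<in> J" "y \<in> carrier A" "a \<in> carrier A" "T \<in> carrier (tensor_sq A C i)"
  shows "slide \<beta> y (lmult_sq A C i a T) = a \<otimes> slide \<beta> y T"
  using assms(4)
proof (induction rule: I.Sq.tensor_induct)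
  case (pure p q)
  then show ?case using assms by (simp add: I.lmult_pair slide_pair m_assoc JD(2))
next
  case (mult T U)
  then show ?case using assms by (simp add: in_hom_mult[OF I.lmult_hom] slide_mult r_distr)
qed

lemma slide_rmult:
  assumes "\<beta> \<in> J" "y \<in> carrier A" "a \<in> carrier A" "T \<in> carrier (tensor_sq A C i)"
  shows "slide \<beta> y (rmult_sq A C i T a) = slide \<beta> (a \<otimes> y) T"
  using assms(4)
proof (induction rule: I.Sq.tensor_induct)
  case (pure p q)
  then show ?case using assms by (simp add: I.rmult_pair slide_pair m_assoc)
next
  case (mult T U)
  then show ?case using assms by (simp add: in_hom_mult[OF I.rmult_hom] slide_mult)
qed

lemma slide_add:
  assumes "\<beta> \<in> J" "y \<in> carrier A" "z \<in> carrier A" "T \<in> carrier (tensor_sq A C i)"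
  shows "slide \<beta> (y \<oplus> z) T = slide \<beta> y T \<oplus> slide \<beta> z T"
  using assms(4)
proof (induction rule: I.Sq.tensor_induct)
  case (pure p q)
  then show ?case using assms by (simp add: slide_pair r_distr JD(2,3))
next
  case (mult T U)
  then show ?case using assms by (simp add: slide_mult E.a_add_add_comm)
qed

lemma slide_right_linear:
  assumes "\<beta> \<in> J" "y \<in> carrier A" "b \<in> carrier B" "T \<in> carrier (tensor_sq A C i)"
  shows "slide \<beta> (y \<otimes> g b) T = slide \<beta> y T \<otimes> g b"
  using assms(4)
proof (induction rule: I.Sq.tensor_induct)
  case (pure p q)
  then show ?case using assms JD(4)[OF assms(1), of "q \<otimes> y" b] by (simp add: slide_pair m_assoc JD(2))
next
  case (mult T U)
  then show ?case using assms by (simp add: slide_mult l_distr)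
qed

text \<open>
  Left \<open>C\<close>-linearity in \<open>y\<close> uses that \<open>T\<close> commutes with \<open>C\<close>: \<open>T\<^sup>1 \<beta>(T\<^sup>2 c y) = c T\<^sup>1 \<beta>(T\<^sup>2 y)\<close>. The
  values are right \<open>B\<close>-linear along with \<open>\<beta>\<close>, which is what makes \<open>J\<close> a left coideal.
\<close>

lemma slide_J:
  assumes \<beta>: "\<beta> \<in> J" and T: "T \<in> carrier (tensor_sq A C i)"
    and central: "\<And>c. c \<in> carrier C \<Longrightarrow> lmult_sq A C i (i c) T = rmult_sq A C i T (i c)"
  shows "(\<lambda>y\<in>carrier A. slide \<beta> y T) \<in> J"
proof -
  have "slide \<beta> (i c \<otimes> y) T = i c \<otimes> slide \<beta> y T" if "c \<in> carrier C" "y \<in> carrier A" for c y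
    using slide_lmult[OF \<beta> that(2) _ T, of "i c"] slide_rmult[OF \<beta> that(2) _ T, of "i c"] central that by simp
  then show ?thesis
    using \<beta> T by (auto simp: J_iff E.End_right_iff slide_add slide_right_linear intro!: additive_mapsI)
qed

text \<open>
  The defining sum of the coproduct for one choice of quasibases, read in \<open>S \<otimes>\<^sub>V J\<close> instead of
  \<open>S \<otimes>\<^sub>V S\<close>.
\<close>

definition coproduct_term :: "('a \<Rightarrow> 'a) \<Rightarrow> nat \<times> (nat \<Rightarrow> 'a \<Rightarrow> 'a) \<times> (nat \<Rightarrow> ('a \<times> 'a \<Rightarrow>\<^sub>0 int) set)
    \<Rightarrow> (('a \<Rightarrow> 'a) \<times> ('a \<Rightarrow> 'a) \<Rightarrow>\<^sub>0 int) set"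
  where "coproduct_term \<beta> = (\<lambda>(m, \<eta>, w). \<Otimes>\<^bsub>S_tensor A C i J\<^esub>k\<in>{..<m}.
    S_pure A C i J (\<eta> k) (\<lambda>y\<in>carrier A. slide \<beta> y (w k)))"

text \<open>
  The evaluation formula \<open>\<beta>\<^sub>1(x) \<beta>\<^sub>2(y) = \<beta>(x y)\<close> arises from \<open>1 \<otimes> x = \<Sum>k. \<eta>\<^sub>k(x) w\<^sub>k\<close> by replacing each tensor
  \<open>p \<otimes> q\<close> with \<open>p \<beta>(q y)\<close>.
\<close>

lemma coproduct_term:
  assumes \<beta>: "\<beta> \<in> J" and D: "D \<in> right_D2_quasibases A C i"
  shows coproduct_term_closed: "coproduct_term \<beta> D \<in> carrier (S_tensor A C i J)"
    and eval_left_coproduct_term: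
      "x \<in> carrier A \<Longrightarrow> eval_left x (coproduct_term \<beta> D) = (\<lambda>y\<in>carrier A. \<beta> (x \<otimes> y))"
proof -
  obtain m \<eta> w where D_eq: "D = (m, \<eta>, w)" by (cases D) auto
  have \<eta>: "\<eta> k \<in> S" and w: "w k \<in> carrier (tensor_sq A C i)"
    and central: "\<And>c. c \<in> carrier C \<Longrightarrow> lmult_sq A C i (i c) (w k) = rmult_sq A C i (w k) (i c)"
    if "k < m" for k
    using D that unfolding right_D2_quasibases_def D_eq by blast+
  have quasibasis: "pure_sq A C i x y = (\<Otimes>\<^bsub>tensor_sq A C i\<^esub>k\<in>{..<m}. lmult_sq A C i (x \<otimes> \<eta> k y) (w k))"
    if "x \<in> carrier A" "y \<in> carrier A" for x y
    using D that unfolding right_D2_quasibases_def D_eq by blast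
  let ?D = "\<lambda>k. \<lambda>y\<in>carrier A. slide \<beta> y (w k)"
  have D_J: "?D k \<in> J" if "k < m" for k
    using slide_J[OF \<beta> w[OF that] central[OF that]] .
  have c: "(\<lambda>k. S_pure A C i J (\<eta> k) (?D k)) \<in> {..<m} \<rightarrow> carrier (S_tensor A C i J)"
    using \<eta> D_J by auto
  have eq: "coproduct_term \<beta> D = (\<Otimes>\<^bsub>S_tensor A C i J\<^esub>k\<in>{..<m}. S_pure A C i J (\<eta> k) (?D k))"
    by (simp add: coproduct_term_def D_eq)
  show "coproduct_term \<beta> D \<in> carrier (S_tensor A C i J)"
    unfolding eq by (rule SJ.MN.finprod_closed[OF c])
  assume x: "x \<in> carrier A"
  have \<eta>x: "\<eta> k x \<in> carrier A" if "k < m" for k using S_closed[OF \<eta>[OF that] x] .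
  have c': "(\<lambda>k. vleft A (\<eta> k x) (?D k)) \<in> {..<m} \<rightarrow> carrier (add_monoid End_AB)"
    using \<eta>x D_J J_End_right E.End_right_vleft by auto
  have "eval_left x (coproduct_term \<beta> D) =
      (\<Otimes>\<^bsub>add_monoid End_AB\<^esub>k\<in>{..<m}. eval_left x (S_pure A C i J (\<eta> k) (?D k)))"
    unfolding eq by (rule hom_finprod[OF eval_left_hom[OF x] SJ.MN.comm_group_axioms E.comm_group_End_right c])
  also have "\<dots> = (\<Otimes>\<^bsub>add_monoid End_AB\<^esub>k\<in>{..<m}. vleft A (\<eta> k x) (?D k))"
    using \<eta> D_J c' eval_left_pure[OF x]
    by (intro comm_monoid.finprod_cong'[OF comm_group.axioms(1)[OF E.comm_group_End_right]]) auto
  finally have eval: "eval_left x (coproduct_term \<beta> D) = \<dots>" .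
  have "eval_left x (coproduct_term \<beta> D) y = \<beta> (x \<otimes> y)" if y: "y \<in> carrier A" for y
  proof -
    have "eval_left x (coproduct_term \<beta> D) y =
        (\<Otimes>\<^bsub>add_monoid A\<^esub>k\<in>{..<m}. vleft A (\<eta> k x) (?D k) y)"
      unfolding eval by (rule hom_finprod[OF E.End_right_eval_hom[OF y] E.comm_group_End_right comm_group_add c'])
    \<comment> \<open>The factor \<open>\<one>\<close> brings the sum into the form of the quasibasis identity for \<open>1 \<otimes> x\<close>.\<close>
    also have "\<dots> = (\<Otimes>\<^bsub>add_monoid A\<^esub>k\<in>{..<m}. slide \<beta> y (lmult_sq A C i (\<one> \<otimes> \<eta> k x) (w k)))"
      using \<eta>x \<beta> y w
      by (intro comm_monoid.finprod_cong'[OF comm_group.axioms(1)[OF comm_group_add]])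
         (auto simp: slide_lmult vleft_def)
    also have "\<dots> = slide \<beta> y (\<Otimes>\<^bsub>tensor_sq A C i\<^esub>k\<in>{..<m}. lmult_sq A C i (\<one> \<otimes> \<eta> k x) (w k))"
      using \<eta>x w
      by (intro hom_finprod[OF slide_hom[OF \<beta> y] I.Sq.MN.comm_group_axioms comm_group_add, symmetric]) auto
    also have "\<dots> = slide \<beta> y (pure_sq A C i \<one> x)"
      unfolding quasibasis[OF one_closed x] ..
    also have "\<dots> = \<beta> (x \<otimes> y)"
      using slide_pair[OF \<beta> y one_closed x] JD(2)[OF \<beta>] x y by simp
    finally show ?thesis .
  qed
  moreover have "eval_left x (coproduct_term \<beta> D) \<in> extensional (carrier A)"
    using additive_mapsD(3)[OF E.End_rightD(1)[OF eval_left_closed[OF x \<open>coproduct_term \<beta> D \<in> carrier (S_tensor A C i J)\<close>]]] .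
  ultimately show "eval_left x (coproduct_term \<beta> D) = (\<lambda>y\<in>carrier A. \<beta> (x \<otimes> y))"
    by (intro extensionalityI[where A="carrier A"]) auto
qed

end

section \<open>The coideal subring\<close>

text \<open>
  Quasibases for \<open>A | B | C\<close> serve for tensors in \<open>S \<otimes>\<^sub>V J\<close> and \<open>A \<otimes>\<^sub>V J\<close>, those of \<open>A | C\<close>, seen as the tower
  \<open>A | C | C\<close>, for tensors in \<open>S \<otimes>\<^sub>V S\<close>.
\<close>

locale depth_three_depth_two =
  depth_three_quasibases A B g C i n u \<gamma> + CC: depth_three_quasibases A C i C i n' u' \<gamma>'
  for A (structure) and B :: "'b ring" and g and C :: "'c ring" and i n u \<gamma> n' u' \<gamma>' +
  assumes J_subset_S: "J \<subseteq> S"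
    and right_quasibases: "right_D2_quasibases A C i \<noteq> {}"
begin

lemma J_S: "h \<in> J \<Longrightarrow> h \<in> S"
  using J_subset_S by blast

text \<open>
  All choices of quasibases give the same element of \<open>S \<otimes>\<^sub>V S\<close>, since their evaluations agree.
\<close>

lemma coproduct_eq:
  assumes \<beta>: "\<beta> \<in> S" and D: "D \<in> right_D2_quasibases A C i"
  shows "coproduct A C i \<beta> = CC.coproduct_term \<beta> D"
proof -
  have "CC.coproduct_term \<beta> D' = CC.coproduct_term \<beta> D" if "D' \<in> right_D2_quasibases A C i" for D'
    using CC.coproduct_term[OF \<beta> that] CC.coproduct_term[OF \<beta> D]
    by (intro CC.S_tensor_eqI) auto
  then have "CC.coproduct_term \<beta> ` right_D2_quasibases A C i = {CC.coproduct_term \<beta> D}"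
    using D by blast
  then show ?thesis
    unfolding coproduct_def CC.coproduct_term_def CC.slide_def by (simp only: the_elem_eq)
qed

lemma coproduct_closed: "\<beta> \<in> S \<Longrightarrow> coproduct A C i \<beta> \<in> carrier (S_tensor A C i S)"
  using coproduct_eq CC.coproduct_term_closed right_quasibases by fastforce

lemma eval_left_coproduct:
  "\<beta> \<in> S \<Longrightarrow> x \<in> carrier A \<Longrightarrow> CC.eval_left x (coproduct A C i \<beta>) = (\<lambda>y\<in>carrier A. \<beta> (x \<otimes> y))"
  using coproduct_eq CC.eval_left_coproduct_term right_quasibases by fastforce

lemma S_incl_balanced:
  "balanced V (add_monoid (End_CC A C i)) (vright A) (add_monoid (map_ring A J)) (vleft A)
    (S_tensor A C i S) (S_pure A C i S)"
  using CC.SJ.balanced_pure J_S unfolding balanced_def by auto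

lemma S_incl_closed: "T \<in> carrier (S_tensor A C i J) \<Longrightarrow> S_incl A C i T \<in> carrier (S_tensor A C i S)"
  unfolding S_incl_def by (rule SJ.lift_closed[OF CC.SJ.MN.comm_group_axioms S_incl_balanced])

lemma S_incl_add:
  "T \<in> carrier (S_tensor A C i J) \<Longrightarrow> U \<in> carrier (S_tensor A C i J) \<Longrightarrow>
    S_incl A C i (T \<otimes>\<^bsub>S_tensor A C i J\<^esub> U) = S_incl A C i T \<otimes>\<^bsub>S_tensor A C i S\<^esub> S_incl A C i U"
  unfolding S_incl_def by (rule SJ.lift_mult[OF CC.SJ.MN.comm_group_axioms S_incl_balanced])

lemma S_incl_pure:
  "\<alpha> \<in> S \<Longrightarrow> \<beta> \<in> J \<Longrightarrow> S_incl A C i (S_pure A C i J \<alpha> \<beta>) = S_pure A C i S \<alpha> \<beta>"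
  unfolding S_incl_def using SJ.lift_pure[OF CC.SJ.MN.comm_group_axioms S_incl_balanced] by simp

lemma eval_left_S_incl:
  assumes x: "x \<in> carrier A" and T: "T \<in> carrier (S_tensor A C i J)"
  shows "CC.eval_left x (S_incl A C i T) = eval_left x T"
  using T
proof (induction rule: SJ.tensor_induct)
  case (pure \<alpha> \<beta>)
  then show ?case using x J_S by (simp add: S_incl_pure eval_left_pure CC.eval_left_pure)
next
  case (mult T U)
  then show ?case using x by (simp add: S_incl_add eval_left_add CC.eval_left_add S_incl_closed)
qed

lemma S_incl_coproduct_term:
  assumes \<beta>: "\<beta> \<in> J" and D: "D \<in> right_D2_quasibases A C i"
  shows "S_incl A C i (coproduct_term \<beta> D) = coproduct A C i \<beta>"
  using coproduct_term[OF \<beta> D] coproduct_closed[OF J_S[OF \<beta>]] eval_left_coproduct[OF J_S[OF \<beta>]]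
  by (intro CC.S_tensor_eqI) (auto simp: S_incl_closed eval_left_S_incl)

text \<open>
  Uniqueness holds because \<open>S \<otimes>\<^sub>V J \<rightarrow> S \<otimes>\<^sub>V S\<close> preserves evaluations, and evaluations separate the
  elements of \<open>S \<otimes>\<^sub>V J\<close>.
\<close>

lemma coideal_coproduct_eq:
  assumes \<beta>: "\<beta> \<in> J" and D: "D \<in> right_D2_quasibases A C i"
  shows "coideal_coproduct A C i J \<beta> = coproduct_term \<beta> D"
  unfolding coideal_coproduct_def
proof (rule the_equality)
  show "coproduct_term \<beta> D \<in> carrier (S_tensor A C i J) \<and> S_incl A C i (coproduct_term \<beta> D) = coproduct A C i \<beta>"
    using coproduct_term_closed[OF \<beta> D] S_incl_coproduct_term[OF \<beta> D] by blast
next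
  fix T assume T: "T \<in> carrier (S_tensor A C i J) \<and> S_incl A C i T = coproduct A C i \<beta>"
  show "T = coproduct_term \<beta> D"
  proof (rule S_tensor_eqI)
    fix x assume x: "x \<in> carrier A"
    show "eval_left x T = eval_left x (coproduct_term \<beta> D)"
      using eval_left_S_incl[OF x, of T] T eval_left_coproduct[OF J_S[OF \<beta>] x]
        eval_left_coproduct_term[OF \<beta> D x] by simp
  qed (use T coproduct_term_closed[OF \<beta> D] in auto)
qed

lemma coideal_coproduct_closed: "\<beta> \<in> J \<Longrightarrow> coideal_coproduct A C i J \<beta> \<in> carrier (S_tensor A C i J)"
  using coideal_coproduct_eq coproduct_term_closed right_quasibases by fastforce

lemma eval_left_coideal_coproduct:
  "\<beta> \<in> J \<Longrightarrow> x \<in> carrier A \<Longrightarrow>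
    eval_left x (coideal_coproduct A C i J \<beta>) = (\<lambda>y\<in>carrier A. \<beta> (x \<otimes> y))"
  using coideal_coproduct_eq eval_left_coproduct_term right_quasibases by fastforce

lemma left_coideal_subring_J: "left_coideal_subring A C i J"
  unfolding left_coideal_subring_def
proof (intro conjI ballI vleft_J subsetI)
  interpret SR: ring "End_CC A C i"
    using CC.ring_J by (simp only: CC.End_bimod_eq[symmetric])
  have simps: "h \<otimes>\<^bsub>End_CC A C i\<^esub> k = compose (carrier A) h k" "\<one>\<^bsub>End_CC A C i\<^esub> = (\<lambda>x\<in>carrier A. x)"
    "\<zero>\<^bsub>End_CC A C i\<^esub> = (\<lambda>x\<in>carrier A. \<zero>)" "h \<oplus>\<^bsub>End_CC A C i\<^esub> k = (\<lambda>x\<in>carrier A. h x \<oplus> k x)" for h k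
    by (simp_all add: End_bimod_def)
  show "subring J (End_CC A C i)"
  proof (rule SR.subringI[OF J_subset_S])
    fix h assume h: "h \<in> J"
    have "(\<lambda>x\<in>carrier A. \<ominus> h x) \<oplus>\<^bsub>End_CC A C i\<^esub> h = \<zero>\<^bsub>End_CC A C i\<^esub>"
      unfolding simps using h by (auto simp: JD(2) l_neg intro!: restrict_ext)
    then have "\<ominus>\<^bsub>End_CC A C i\<^esub> h = (\<lambda>x\<in>carrier A. \<ominus> h x)"
      using J_S[OF h] J_S[OF J_neg[OF h]] by (rule SR.minus_equality)
    then show "\<ominus>\<^bsub>End_CC A C i\<^esub> h \<in> J" using J_neg[OF h] by simp
  qed (simp_all only: simps J_id J_compose J_add)
  fix T assume "T \<in> coproduct A C i ` J"
  then obtain \<beta> where \<beta>: "\<beta> \<in> J" "T = coproduct A C i \<beta>" by blast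
  obtain D where D: "D \<in> right_D2_quasibases A C i" using right_quasibases by blast
  show "T \<in> S_incl A C i ` carrier (S_tensor A C i J)"
    using S_incl_coproduct_term[OF \<beta>(1) D] coproduct_term_closed[OF \<beta>(1) D] \<beta>(2) by (metis image_eqI)
qed

end

section \<open>The smash product\<close>

context depth_three_depth_two
begin

abbreviation "Sg \<equiv> smash_group A C i J"
abbreviation "End_grp \<equiv> add_monoid End_AB :: ('a \<Rightarrow> 'a) monoid"

lemma vleft_hom: "a \<in> carrier A \<Longrightarrow> vleft A a \<in> hom End_grp End_grp"
  by (intro homI) (simp_all add: E.End_right_vleft vleft_add_right del: E.End_right_simps)

lemma compose_left_hom:
  "h \<in> carrier End_AB \<Longrightarrow> (\<lambda>k. compose (carrier A) h k) \<in> hom End_grp End_grp"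
  using E.ER.r_distr[of _ _ h] by (intro homI) (simp_all add: E.End_right_compose)

lemma compose_right_hom:
  "k \<in> carrier End_AB \<Longrightarrow> (\<lambda>h. compose (carrier A) h k) \<in> hom End_grp End_grp"
  using E.ER.l_distr[of _ _ k] by (intro homI) (simp_all add: E.End_right_compose)

text \<open>The product \<open>(a # \<alpha>)(b # \<beta>)\<close>.\<close>

definition pure_mult :: "'a \<Rightarrow> ('a \<Rightarrow> 'a) \<Rightarrow> 'a \<Rightarrow> ('a \<Rightarrow> 'a) \<Rightarrow> ('a \<times> ('a \<Rightarrow> 'a) \<Rightarrow>\<^sub>0 int) set"
  where "pure_mult a \<alpha> b \<beta> =
    tensor_lift Sg (\<lambda>\<sigma> \<tau>. smash_pure A C i J (a \<otimes> \<sigma> b) (compose (carrier A) \<tau> \<beta>))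
      (coideal_coproduct A C i J \<alpha>)"

text \<open>
  The value is \<open>x \<mapsto> a \<alpha>\<^sub>1(b) \<alpha>\<^sub>2(\<beta>(x)) = a \<alpha>(b \<beta>(x))\<close>, by the evaluation formula for the coproduct.
\<close>

lemma pure_mult:
  assumes a: "a \<in> carrier A" and \<alpha>: "\<alpha> \<in> J" and b: "b \<in> carrier A" and \<beta>: "\<beta> \<in> J"
  shows pure_mult_closed: "pure_mult a \<alpha> b \<beta> \<in> carrier Sg"
    and smash_action_pure_mult:
      "smash_action (pure_mult a \<alpha> b \<beta>) = compose (carrier A) (vleft A a \<alpha>) (vleft A b \<beta>)"
proof -
  let ?\<phi> = "\<lambda>\<sigma> \<tau>. smash_pure A C i J (a \<otimes> \<sigma> b) (compose (carrier A) \<tau> \<beta>)"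
  let ?\<Psi> = "\<lambda>h. compose (carrier A) (vleft A a h) \<beta>"
  have \<Psi>: "?\<Psi> \<in> hom End_grp End_grp"
    using hom_compose[OF vleft_hom[OF a] compose_right_hom[OF J_End_right[OF \<beta>]]] by (simp add: comp_def)
  have closed: "?\<phi> s t \<in> carrier Sg" if "s \<in> S" "t \<in> J" for s t
    using that a b \<beta> by (simp add: S_closed J_compose)
  have square: "smash_action (?\<phi> s t) = ?\<Psi> (vleft A (s b) t)" if "s \<in> S" "t \<in> J" for s t
    using that a b \<beta> S_closed[OF that(1) b]
    by (simp add: smash_action_pure J_compose)
       (auto simp: vleft_def compose_def JD(2) m_assoc intro!: restrict_ext)
  note reflect = SJ.balanced_reflect[where \<Phi>=smash_action and \<psi>="\<lambda>\<sigma> \<tau>. vleft A (\<sigma> b) \<tau>"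
      and \<Psi>="?\<Psi>" and \<phi>="?\<phi>", OF Sm.MN.comm_group_axioms E.comm_group_End_right smash_action_hom
      smash_action_inj \<Psi> eval_left_balanced[OF b]]
  note lift = SJ.lift_square[where \<Phi>=smash_action and \<psi>="\<lambda>\<sigma> \<tau>. vleft A (\<sigma> b) \<tau>"
      and \<Psi>="?\<Psi>" and \<phi>="?\<phi>", OF Sm.MN.comm_group_axioms E.comm_group_End_right smash_action_hom
      smash_action_inj \<Psi> eval_left_balanced[OF b] _ _ E.comm_group_End_right coideal_coproduct_closed[OF \<alpha>]]
  show "pure_mult a \<alpha> b \<beta> \<in> carrier Sg"
    unfolding pure_mult_def
    by (rule SJ.lift_closed[OF Sm.MN.comm_group_axioms reflect coideal_coproduct_closed[OF \<alpha>]])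
       (erule (1) closed, erule (1) square)
  have "smash_action (pure_mult a \<alpha> b \<beta>) = ?\<Psi> (eval_left b (coideal_coproduct A C i J \<alpha>))"
    unfolding pure_mult_def eval_left_def by (rule lift) (erule (1) closed, erule (1) square)
  also have "\<dots> = compose (carrier A) (vleft A a \<alpha>) (vleft A b \<beta>)"
    unfolding eval_left_coideal_coproduct[OF \<alpha> b] using a b \<beta>
    by (auto simp: vleft_def compose_def JD(2) intro!: restrict_ext)
  finally show "smash_action (pure_mult a \<alpha> b \<beta>) = compose (carrier A) (vleft A a \<alpha>) (vleft A b \<beta>)" .
qed

text \<open>
  The two remaining biadditive extensions are well defined because composition of endomorphisms is
  biadditive and the action is injective.
\<close>

lemma left_pure_mult:
  assumes a: "a \<in> carrier A" and \<alpha>: "\<alpha> \<in> J" and U: "U \<in> carrier Sg"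
  shows left_pure_mult_closed: "tensor_lift Sg (pure_mult a \<alpha>) U \<in> carrier Sg"
    and smash_action_left_pure_mult:
      "smash_action (tensor_lift Sg (pure_mult a \<alpha>) U) = compose (carrier A) (vleft A a \<alpha>) (smash_action U)"
proof -
  have h: "vleft A a \<alpha> \<in> carrier End_AB" using E.End_right_vleft[OF J_End_right[OF \<alpha>] a] .
  note reflect = Sm.balanced_reflect[where \<Phi>=smash_action and \<psi>="vleft A"
      and \<Psi>="compose (carrier A) (vleft A a \<alpha>)"
      and \<phi>="pure_mult a \<alpha>", OF Sm.MN.comm_group_axioms E.comm_group_End_right smash_action_hom
      smash_action_inj compose_left_hom[OF h] smash_action_balanced pure_mult_closed[OF a \<alpha>]
      smash_action_pure_mult[OF a \<alpha>]]
  note lift = Sm.lift_square[where \<Phi>=smash_action and \<psi>="vleft A"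
      and \<Psi>="compose (carrier A) (vleft A a \<alpha>)"
      and \<phi>="pure_mult a \<alpha>", OF Sm.MN.comm_group_axioms E.comm_group_End_right smash_action_hom
      smash_action_inj compose_left_hom[OF h] smash_action_balanced pure_mult_closed[OF a \<alpha>]
      smash_action_pure_mult[OF a \<alpha>] E.comm_group_End_right U]
  show "tensor_lift Sg (pure_mult a \<alpha>) U \<in> carrier Sg"
    by (rule Sm.lift_closed[OF Sm.MN.comm_group_axioms reflect U]) simp_all
  show "smash_action (tensor_lift Sg (pure_mult a \<alpha>) U) = compose (carrier A) (vleft A a \<alpha>) (smash_action U)"
    by (rule lift[folded smash_action_def]) simp_all
qed

lemma smash_mult_eq:
  "smash_mult A C i J T U = tensor_lift Sg (\<lambda>a \<alpha>. tensor_lift Sg (pure_mult a \<alpha>) U) T"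
  unfolding smash_mult_def pure_mult_def ..

lemma smash_mult:
  assumes T: "T \<in> carrier Sg" and U: "U \<in> carrier Sg"
  shows smash_mult_closed: "smash_mult A C i J T U \<in> carrier Sg"
    and smash_action_mult:
      "smash_action (smash_mult A C i J T U) = compose (carrier A) (smash_action T) (smash_action U)"
proof -
  note k = compose_right_hom[OF smash_action_closed[OF U]]
  note reflect = Sm.balanced_reflect[where \<Phi>=smash_action and \<psi>="vleft A"
      and \<Psi>="\<lambda>h. compose (carrier A) h (smash_action U)"
      and \<phi>="\<lambda>a \<alpha>. tensor_lift Sg (pure_mult a \<alpha>) U", OF Sm.MN.comm_group_axioms E.comm_group_End_right smash_action_hom
      smash_action_inj k smash_action_balanced left_pure_mult_closed[OF _ _ U]
      smash_action_left_pure_mult[OF _ _ U]]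
  note lift = Sm.lift_square[where \<Phi>=smash_action and \<psi>="vleft A"
      and \<Psi>="\<lambda>h. compose (carrier A) h (smash_action U)"
      and \<phi>="\<lambda>a \<alpha>. tensor_lift Sg (pure_mult a \<alpha>) U", OF Sm.MN.comm_group_axioms E.comm_group_End_right smash_action_hom
      smash_action_inj k smash_action_balanced left_pure_mult_closed[OF _ _ U]
      smash_action_left_pure_mult[OF _ _ U] E.comm_group_End_right T]
  show "smash_mult A C i J T U \<in> carrier Sg"
    unfolding smash_mult_eq
    by (rule Sm.lift_closed[OF Sm.MN.comm_group_axioms reflect T]) simp_all
  show "smash_action (smash_mult A C i J T U) = compose (carrier A) (smash_action T) (smash_action U)"
    unfolding smash_mult_eq by (rule lift[folded smash_action_def]) simp_all
qed

definition smash_inverse :: "('a \<Rightarrow> 'a) \<Rightarrow> ('a \<times> ('a \<Rightarrow> 'a) \<Rightarrow>\<^sub>0 int) set"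
  where "smash_inverse = inv_into (carrier Sg) smash_action"

lemma smash_inverse_closed: "h \<in> carrier End_AB \<Longrightarrow> smash_inverse h \<in> carrier Sg"
  unfolding smash_inverse_def using smash_action_bij by (metis bij_betw_def inv_into_into)

lemma smash_inverse_eqI: "T \<in> carrier Sg \<Longrightarrow> smash_action T = h \<Longrightarrow> smash_inverse h = T"
  unfolding smash_inverse_def using smash_action_inj by (metis inv_into_f_f)

lemma smash_action_inverse: "h \<in> carrier End_AB \<Longrightarrow> smash_action (smash_inverse h) = h"
  unfolding smash_inverse_def using smash_action_bij by (metis bij_betw_def f_inv_into_f)

lemma smash_inverse_iso: "smash_inverse \<in> ring_iso End_AB (smash_product A C i J)"
proof -
  have "smash_inverse \<in> ring_hom End_AB (smash_product A C i J)"
  proof (rule ring_hom_memI)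
    fix h k assume h: "h \<in> carrier End_AB" and k: "k \<in> carrier End_AB"
    note hk = smash_inverse_closed[OF h] smash_inverse_closed[OF k]
    show "smash_inverse h \<in> carrier (smash_product A C i J)"
      using hk by (simp add: smash_product_def)
    show "smash_inverse (h \<otimes>\<^bsub>End_AB\<^esub> k) = smash_inverse h \<otimes>\<^bsub>smash_product A C i J\<^esub> smash_inverse k"
      by (rule smash_inverse_eqI)
         (simp_all add: smash_product_def smash_mult[OF hk] smash_action_inverse h k)
    show "smash_inverse (h \<oplus>\<^bsub>End_AB\<^esub> k) = smash_inverse h \<oplus>\<^bsub>smash_product A C i J\<^esub> smash_inverse k"
      by (rule smash_inverse_eqI)
         (simp_all add: smash_product_def smash_action_add[OF hk] Sm.MN.m_closed[OF hk]
           smash_action_inverse h k)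
  next
    have "smash_action (smash_pure A C i J \<one> (\<lambda>x\<in>carrier A. x)) = (\<lambda>x\<in>carrier A. x)"
      unfolding smash_action_pure[OF one_closed J_id] by (auto simp: vleft_def intro!: restrict_ext)
    then show "smash_inverse \<one>\<^bsub>End_AB\<^esub> = \<one>\<^bsub>smash_product A C i J\<^esub>"
      by (intro smash_inverse_eqI) (simp_all add: smash_product_def J_id)
  qed
  moreover have "bij_betw smash_inverse (carrier End_AB) (carrier (smash_product A C i J))"
    unfolding smash_inverse_def using bij_betw_inv_into[OF smash_action_bij] by (simp add: smash_product_def)
  ultimately show ?thesis by (simp add: ring_iso_def)
qed

lemma ring_smash_product: "ring (smash_product A C i J)"
proof -
  have "smash_action \<one>\<^bsub>Sg\<^esub> = \<zero>\<^bsub>End_AB\<^esub>"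
    using hom_one[OF smash_action_hom Sm.MN.group_axioms comm_group.axioms(2)[OF E.comm_group_End_right]]
    by simp
  then have "smash_inverse \<zero>\<^bsub>End_AB\<^esub> = \<zero>\<^bsub>smash_product A C i J\<^esub>"
    by (intro smash_inverse_eqI) (simp_all add: smash_product_def del: E.End_right_simps)
  moreover have "ring ((smash_product A C i J)\<lparr>zero := smash_inverse \<zero>\<^bsub>End_AB\<^esub>\<rparr>)"
    by (rule E.ER.ring_iso_imp_img_ring[OF smash_inverse_iso])
  ultimately show ?thesis by simp
qed

end

theorem corollary5p2:
  fixes A :: "'a ring" and B :: "'b ring" and C :: "'c ring"
    and f :: "'c \<Rightarrow> 'b" and g :: "'b \<Rightarrow> 'a"
  assumes "ring A" and "ring B" and "ring C"
    and "f \<in> ring_hom C B" and "g \<in> ring_hom B A"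
    and "left_depth_three A B C g f"
    and "depth_two A C (g \<circ> f)"
  shows "left_coideal_subring A C (g \<circ> f) (carrier (End_bimod A C (g \<circ> f) B g))
    \<and> ring (smash_product A C (g \<circ> f) (carrier (End_bimod A C (g \<circ> f) B g)))
    \<and> End_right A B g \<simeq> smash_product A C (g \<circ> f) (carrier (End_bimod A C (g \<circ> f) B g))"
proof -
  let ?i = "g \<circ> f"
  have i: "?i \<in> ring_hom C A" using assms(4,5) by (rule ring_hom_trans)
  interpret ABC: extension_pair A B g C ?i
    using assms(1-3,5) i
    by (intro extension_pair.intro ring_extension.intro ring_extension_axioms.intro plain_ring.intro)
  interpret ACC: extension_pair A C ?i C ?i
    using assms(1-3,5) i
    by (intro extension_pair.intro ring_extension.intro ring_extension_axioms.intro plain_ring.intro)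
  obtain n u \<gamma> where left: "depth_three_quasibases A B g C ?i n u \<gamma>"
    using assms(6) ABC.left_quasibases_exist unfolding left_depth_three_def by blast
  obtain n' u' \<gamma>' where left': "depth_three_quasibases A C ?i C ?i n' u' \<gamma>'"
    using assms(7) ACC.left_quasibases_exist unfolding depth_two_def by blast
  have right: "right_D2_quasibases A C ?i \<noteq> {}"
    using assms(7) ACC.right_quasibases_exist unfolding depth_two_def by blast
  \<comment> \<open>Right \<open>B\<close>-linear maps are right \<open>C\<close>-linear, as \<open>C\<close> acts through \<open>B\<close>.\<close>
  have "h (x \<otimes>\<^bsub>A\<^esub> ?i c) = h x \<otimes>\<^bsub>A\<^esub> ?i c"
    if "h \<in> ABC.J" "x \<in> carrier A" "c \<in> carrier C" for h x c
    using ABC.JD(4)[OF that(1,2), of "f c"] ring_hom_closed[OF assms(4) that(3)] by simp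
  then have "ABC.J \<subseteq> ABC.S"
    using ABC.JD(1) ABC.J_left_linear by (auto simp: ABC.S_iff ABC.I.End_right_iff)
  then interpret depth_three_depth_two A B g C ?i n u \<gamma> n' u' \<gamma>'
    using left left' right
    by (intro depth_three_depth_two.intro depth_three_depth_two_axioms.intro)
  show ?thesis
    using left_coideal_subring_J ring_smash_product smash_inverse_iso unfolding is_ring_iso_def by blast
qed

end
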